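(* There exists $\varepsilon_0>0$ such that for every $0<\varepsilon<\varepsilon_0$ there exists a constant $c>0$, depending on $\varepsilon$ but not on $n$, such that $$\operatorname{Var}[L_n]\ \ge\ c\cdot n\qquad\text{for all } n\ge 1 .$$
   Context: Let $0<\varepsilon\le 1/2$. $X_1,X_2,\ldots$ and $Y_1,Y_2,\ldots$ are two independent sequences of i.i.d. Bernoulli random variables with $P(X_i=1)=P(Y_i=1)=\varepsilon=1-P(X_i=0)=1-P(Y_i=0)$. Put $X=X_1\cdots X_n$ and $Y=Y_1\cdots Y_n$. $L_n$ denotes the length of the longest common subsequence of $X$ and $Y$, i.e. the largest $k$ for which there are indices $1\le i_1<\cdots<i_k\le n$ and $1\le j_1<\cdots<j_k\le n$ with $X_{i_l}=Y_{j_l}$ for $l=1,\ldots,k$. *)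

theory Defs
  imports "HOL-Probability.Probability"
begin

(* Sequences are indexed from 1; the value at index 0 is never used. *)

definition common_subsequence_length ::
  "(nat \<Rightarrow> 'b) \<Rightarrow> (nat \<Rightarrow> 'b) \<Rightarrow> nat \<Rightarrow> nat \<Rightarrow> bool" where
  "common_subsequence_length x y n k \<longleftrightarrow>
     (\<exists>i j :: nat \<Rightarrow> nat.
        strict_mono_on {1..k} i \<and> i ` {1..k} \<subseteq> {1..n} \<and>
        strict_mono_on {1..k} j \<and> j ` {1..k} \<subseteq> {1..n} \<and>
        (\<forall>l\<in>{1..k}. x (i l) = y (j l)))"

definition LCS_length :: "(nat \<Rightarrow> 'b) \<Rightarrow> (nat \<Rightarrow> 'b) \<Rightarrow> nat \<Rightarrow> nat" where
  "LCS_length x y n = Max {k. common_subsequence_length x y n k}"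

(* The maximum is taken over a finite nonempty set. *)

lemma common_subsequence_length_0: "common_subsequence_length x y n 0"
  by (simp add: common_subsequence_length_def)

lemma common_subsequence_length_le:
  assumes "common_subsequence_length x y n k"
  shows "k \<le> n"
proof -
  obtain i :: "nat \<Rightarrow> nat" where "strict_mono_on {1..k} i" "i ` {1..k} \<subseteq> {1..n}"
    using assms unfolding common_subsequence_length_def by blast
  then have "card {1..k} \<le> card {1..n}"
    by (intro card_inj_on_le[of i] strict_mono_on_imp_inj_on) auto
  then show ?thesis by simp
qed

lemma finite_common_subsequence_lengths: "finite {k. common_subsequence_length x y n k}"
  by (rule finite_subset[of _ "{..n}"]) (auto dest: common_subsequence_length_le)

(* The letters 1 and 0 are encoded as True and False, as in bernoulli_pmf.  The last conjunct
   says that the two sequences, as random elements of the product space, are independent. *)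

definition indep_iid_bernoulli_sequences ::
  "'a measure \<Rightarrow> real \<Rightarrow> (nat \<Rightarrow> 'a \<Rightarrow> bool) \<Rightarrow> (nat \<Rightarrow> 'a \<Rightarrow> bool) \<Rightarrow> bool" where
  "indep_iid_bernoulli_sequences M \<epsilon> X Y \<longleftrightarrow>
     prob_space M \<and>
     prob_space.indep_vars M (\<lambda>_. count_space UNIV) X {1..} \<and>
     prob_space.indep_vars M (\<lambda>_. count_space UNIV) Y {1..} \<and>
     (\<forall>i\<ge>1. distr M (count_space UNIV) (X i) = measure_pmf (bernoulli_pmf \<epsilon>)) \<and>
     (\<forall>i\<ge>1. distr M (count_space UNIV) (Y i) = measure_pmf (bernoulli_pmf \<epsilon>)) \<and>
     prob_space.indep_var M
       (PiM {1..} (\<lambda>_. count_space UNIV)) (\<lambda>\<omega>. \<lambda>i\<in>{1..}. X i \<omega>)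
       (PiM {1..} (\<lambda>_. count_space UNIV)) (\<lambda>\<omega>. \<lambda>i\<in>{1..}. Y i \<omega>)"

end

theory Submission
  imports Defs "HOL-Library.Sublist"
begin

text \<open>
Write \<open>L\<close> for the length of the longest common subsequence of two independent Bernoulli words of length \<open>m\<close>,
with \<open>p\<close> the probability of a one, and \<open>N, N'\<close> and \<open>Z, Z'\<close> for the numbers of ones and of zeros in the two
words.  The variance of \<open>L\<close> is bounded from below by the Cauchy-Schwarz inequality, tested against the
centred statistic \<open>T = N N' / p\<^sup>2 - Z Z' / (1 - p)\<^sup>2\<close> (\<open>contrast\<close>).  Its second moment is of
order \<open>m\<^sup>3\<close>, so it suffices that \<open>E[L T]\<close> is at most a negative multiple of \<open>m\<^sup>2\<close>; this
gives \<open>Var L\<close> at least of order \<open>m\<^sup>4 / m\<^sup>3\<close>.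

Expanding the products of counts, \<open>E[L T]\<close> is the sum over all pairs of positions \<open>(i, j)\<close> of a difference of two
means: a one, respectively a zero, is inserted at position \<open>i\<close> of the first and at position \<open>j\<close> of the second of two
words of length \<open>m - 1\<close>.  Letters are inserted into both words at once because a zero inserted into a single word
need not increase \<open>L\<close> on average: the other word may lack a partner for it.

Two inserted zeros increase the mean by almost 1 (\<open>mean_ins_False_False_ge\<close>).  Indeed the mean over words of
length \<open>m\<close> exceeds that over length \<open>m - 1\<close> by at least \<open>(1 - p)\<^sup>2\<close>, as two equal letters can be put in front of
the words; and for small \<open>p\<close> a pair of random letters is nearly always a pair of zeros, wherever it is inserted.

Two inserted ones hardly increase the mean (\<open>sum_mean_ins_True_True_le\<close>), because a one can only help
if an optimal common subsequence uses it, and optimal common subsequences use few ones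
(\<open>expected_opt_subseq_ones_le\<close>).  For the latter, let \<open>K\<close> be the number of matched pairs of ones and \<open>U\<close> the
number of unmatched letters.  Matching zeros only shows \<open>U \<le> 2 (N + N')\<close>, which is of order \<open>p m\<close>.  On the other
hand, once a matching of ones is prescribed, the letters are ones there with probability \<open>p\<^sup>2\<close> per pair, and
changes of the shift between the two words are bounded by \<open>U\<close>.  Weighting every matching of ones by
\<open>1 / p\<close> for each pair and \<open>1 / 2\<close> for each unit of shift turns this into
\<open>E[p powr (- K) * 2 powr (- U)] \<le> (1 + 3 p) ^ m\<close>, and Jensen's inequality yields
\<open>E[K] * ln (1 / p) \<le> 7 p m\<close>.  For \<open>p \<le> exp (- 56)\<close> at most an eighth of the ones is thus expected to be matched.

These estimates need \<open>p m\<close> to be large.  For the finitely many remaining lengths the variance is positive because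
both \<open>L = 0\<close> and \<open>L = m\<close> occur with positive probability.
\<close>

section \<open>Expectations over Bernoulli words\<close>

text \<open>
The expectation of a function of \<open>n\<close> independent letters, each a one (\<^const>\<open>True\<close>) with probability \<open>p\<close>.
As only finitely many letters matter, this recursion on the first letter replaces a product measure and
makes every expectation a finite sum without side conditions; \<open>expectation_eq_bexp2\<close> links it to
probability spaces.
\<close>

primrec bexp :: "real \<Rightarrow> nat \<Rightarrow> (bool list \<Rightarrow> real) \<Rightarrow> real" where
  "bexp p 0 F = F []"
| "bexp p (Suc n) F = p * bexp p n (\<lambda>xs. F (True # xs)) + (1 - p) * bexp p n (\<lambda>xs. F (False # xs))"

lemma bexp_cong:
  "(\<And>xs. length xs = n \<Longrightarrow> F xs = G xs) \<Longrightarrow> bexp p n F = bexp p n G"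
proof (induction n arbitrary: F G)
  case (Suc n)
  have "bexp p n (\<lambda>xs. F (b # xs)) = bexp p n (\<lambda>xs. G (b # xs))" for b
    by (rule Suc.IH) (simp add: Suc.prems)
  then show ?case by simp
qed simp

lemma bexp_mono:
  assumes "0 \<le> p" "p \<le> 1" "\<And>xs. length xs = n \<Longrightarrow> F xs \<le> G xs"
  shows "bexp p n F \<le> bexp p n G"
  using assms(3)
proof (induction n arbitrary: F G)
  case (Suc n)
  have "bexp p n (\<lambda>xs. F (b # xs)) \<le> bexp p n (\<lambda>xs. G (b # xs))" for b
    by (rule Suc.IH) (simp add: Suc.prems)
  then show ?case using assms by (simp add: add_mono mult_left_mono)
qed simp

lemma bexp_const [simp]: "bexp p n (\<lambda>_. c) = c"
  by (induction n) (simp_all add: algebra_simps)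

lemma bexp_add: "bexp p n (\<lambda>xs. F xs + G xs) = bexp p n F + bexp p n G"
  by (induction n arbitrary: F G) (simp_all add: algebra_simps)

lemma bexp_cmult: "bexp p n (\<lambda>xs. c * F xs) = c * bexp p n F"
  by (induction n arbitrary: F) (simp_all add: algebra_simps)

lemma bexp_multc: "bexp p n (\<lambda>xs. F xs * c) = bexp p n F * c"
  using bexp_cmult[of p n c F] by (simp add: mult.commute)

lemma bexp_diff: "bexp p n (\<lambda>xs. F xs - G xs) = bexp p n F - bexp p n G"
  using bexp_add[of p n F "\<lambda>xs. (-1) * G xs"] unfolding bexp_cmult by simp

lemma bexp_sum: "bexp p n (\<lambda>xs. \<Sum>i\<in>A. F i xs) = (\<Sum>i\<in>A. bexp p n (F i))"
  by (induction A rule: infinite_finite_induct) (simp_all add: bexp_add)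

lemma bexp_drop: "k \<le> n \<Longrightarrow> bexp p n (\<lambda>xs. F (drop k xs)) = bexp p (n - k) F"
proof (induction k arbitrary: n)
  case (Suc k)
  then obtain n' where "n = Suc n'" by (cases n) auto
  with Suc show ?case by (simp add: algebra_simps)
qed simp

definition insert_at :: "nat \<Rightarrow> 'a \<Rightarrow> 'a list \<Rightarrow> 'a list" where
  "insert_at i s xs = take i xs @ s # drop i xs"

definition delete_at :: "nat \<Rightarrow> 'a list \<Rightarrow> 'a list" where
  "delete_at i xs = take i xs @ drop (Suc i) xs"

text \<open>
The letters are exchangeable, so any position can play the role of the first letter in the recursion.
\<close>

lemma bexp_insert_at:
  "i \<le> n \<Longrightarrow> bexp p (Suc n) F = p * bexp p n (\<lambda>xs. F (insert_at i True xs)) + (1 - p) * bexp p n (\<lambda>xs. F (insert_at i False xs))"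
proof (induction i arbitrary: n F)
  case (Suc i)
  then obtain n' where n: "n = Suc n'" by (cases n) auto
  have "bexp p n (\<lambda>xs. F (b # xs)) = p * bexp p n' (\<lambda>xs. F (b # insert_at i True xs)) + (1 - p) * bexp p n' (\<lambda>xs. F (b # insert_at i False xs))" for b
    unfolding n by (rule Suc.IH) (use Suc.prems n in simp)
  then show ?case
    by (simp only: bexp.simps) (simp add: n insert_at_def algebra_simps)
qed (simp add: insert_at_def)

lemma insert_at_nth: "i \<le> length xs \<Longrightarrow> insert_at i s xs ! i = s"
  by (simp add: insert_at_def nth_append)

lemma delete_at_insert_at: "i \<le> length xs \<Longrightarrow> delete_at i (insert_at i s xs) = xs"
  by (simp add: insert_at_def delete_at_def)

definition bern_weight :: "real \<Rightarrow> bool \<Rightarrow> real" where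
  "bern_weight p s = (if s then p else 1 - p)"

text \<open>
Conditioning on the letter at position \<open>i\<close> leaves the other letters independent: summed over \<open>i\<close>, this
trades counts of ones or zeros for insertions into shorter words.
\<close>

lemma bexp_restrict_nth:
  assumes "i \<le> n"
  shows "bexp p (Suc n) (\<lambda>xs. of_bool (xs ! i = s) * F xs) = bern_weight p s * bexp p n (\<lambda>xs. F (insert_at i s xs))"
proof -
  have "bexp p n (\<lambda>xs. of_bool (insert_at i b xs ! i = s) * F (insert_at i b xs)) = of_bool (b = s) * bexp p n (\<lambda>xs. F (insert_at i b xs))" for b
    by (subst bexp_cmult[symmetric], rule bexp_cong) (simp add: insert_at_nth assms)
  then show ?thesis
    by (subst bexp_insert_at[OF assms]) (auto simp: bern_weight_def)
qed

lemma bexp_insert_at_sum: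
  "i \<le> n \<Longrightarrow> bexp p (Suc n) F = (\<Sum>s\<in>UNIV. bern_weight p s * bexp p n (\<lambda>xs. F (insert_at i s xs)))"
  by (simp add: bexp_insert_at UNIV_bool bern_weight_def del: bexp.simps)

definition bexp2 :: "real \<Rightarrow> nat \<Rightarrow> nat \<Rightarrow> (bool list \<Rightarrow> bool list \<Rightarrow> real) \<Rightarrow> real" where
  "bexp2 p a b F = bexp p a (\<lambda>xs. bexp p b (F xs))"

lemma bexp2_cong:
  "(\<And>xs ys. length xs = a \<Longrightarrow> length ys = b \<Longrightarrow> F xs ys = G xs ys) \<Longrightarrow> bexp2 p a b F = bexp2 p a b G"
  unfolding bexp2_def by (intro bexp_cong) simp

lemma bexp2_mono:
  assumes "0 \<le> p" "p \<le> 1"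
    and "\<And>xs ys. length xs = a \<Longrightarrow> length ys = b \<Longrightarrow> F xs ys \<le> G xs ys"
  shows "bexp2 p a b F \<le> bexp2 p a b G"
  unfolding bexp2_def by (intro bexp_mono assms)

lemma bexp2_const [simp]: "bexp2 p a b (\<lambda>_ _. c) = c"
  by (simp add: bexp2_def)

lemma bexp2_add: "bexp2 p a b (\<lambda>xs ys. F xs ys + G xs ys) = bexp2 p a b F + bexp2 p a b G"
  by (simp add: bexp2_def bexp_add)

lemma bexp2_diff: "bexp2 p a b (\<lambda>xs ys. F xs ys - G xs ys) = bexp2 p a b F - bexp2 p a b G"
  by (simp add: bexp2_def bexp_diff)

lemma bexp2_cmult: "bexp2 p a b (\<lambda>xs ys. c * F xs ys) = c * bexp2 p a b F"
  by (simp add: bexp2_def bexp_cmult)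

lemma bexp2_sum: "bexp2 p a b (\<lambda>xs ys. \<Sum>i\<in>A. F i xs ys) = (\<Sum>i\<in>A. bexp2 p a b (F i))"
  by (simp add: bexp2_def bexp_sum)

lemma bexp2_prod: "bexp2 p a b (\<lambda>xs ys. F xs * G ys) = bexp p a F * bexp p b G"
  by (simp add: bexp2_def bexp_cmult bexp_multc)

lemma bexp2_left: "bexp2 p a b (\<lambda>xs ys. F xs) = bexp p a F"
  by (simp add: bexp2_def)

lemma bexp2_right: "bexp2 p a b (\<lambda>xs ys. F ys) = bexp p b F"
  by (simp add: bexp2_def)

lemma bexp2_restrict_nth:
  assumes "i \<le> n" "j \<le> n'"
  shows "bexp2 p (Suc n) (Suc n') (\<lambda>xs ys. of_bool (xs ! i = s \<and> ys ! j = t) * F xs ys)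
    = bern_weight p s * bern_weight p t * bexp2 p n n' (\<lambda>xs ys. F (insert_at i s xs) (insert_at j t ys))"
proof -
  have "bexp2 p (Suc n) (Suc n') (\<lambda>xs ys. of_bool (xs ! i = s \<and> ys ! j = t) * F xs ys)
     = bexp p (Suc n) (\<lambda>xs. of_bool (xs ! i = s) * bexp p (Suc n') (\<lambda>ys. of_bool (ys ! j = t) * F xs ys))"
    by (simp only: bexp2_def bexp_cmult[symmetric] of_bool_conj mult.assoc)
  also have "\<dots> = bern_weight p s * bern_weight p t * bexp2 p n n' (\<lambda>xs ys. F (insert_at i s xs) (insert_at j t ys))"
    by (simp add: bexp_restrict_nth assms bexp2_def bexp_cmult del: bexp.simps)
  finally show ?thesis .
qed

lemma bexp2_insert_at:
  assumes "i \<le> n" "j \<le> n'"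
  shows "bexp2 p (Suc n) (Suc n') F = (\<Sum>s\<in>UNIV. \<Sum>t\<in>UNIV. bern_weight p s * bern_weight p t * bexp2 p n n' (\<lambda>xs ys. F (insert_at i s xs) (insert_at j t ys)))"
  unfolding bexp2_def bexp_insert_at_sum[OF assms(1)]
  by (simp only: bexp_insert_at_sum[OF assms(2)] bexp_sum bexp_cmult sum_distrib_left mult.assoc)

text \<open>
The discriminant argument: the expectation of \<open>(s F - t G)\<^sup>2\<close> is a nonnegative quadratic form in \<open>s, t\<close>.
\<close>

lemma bexp2_Cauchy_Schwarz:
  assumes p: "0 \<le> p" "p \<le> 1"
  shows "(bexp2 p a b (\<lambda>xs ys. F xs ys * G xs ys))\<^sup>2
    \<le> bexp2 p a b (\<lambda>xs ys. (F xs ys)\<^sup>2) * bexp2 p a b (\<lambda>xs ys. (G xs ys)\<^sup>2)"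
proof -
  define A B C where "A = bexp2 p a b (\<lambda>xs ys. (F xs ys)\<^sup>2)"
    and "B = bexp2 p a b (\<lambda>xs ys. (G xs ys)\<^sup>2)"
    and "C = bexp2 p a b (\<lambda>xs ys. F xs ys * G xs ys)"
  have q: "0 \<le> s\<^sup>2 * A - 2 * s * t * C + t\<^sup>2 * B" for s t
  proof -
    have "0 = bexp2 p a b (\<lambda>_ _. 0)" by simp
    also have "\<dots> \<le> bexp2 p a b (\<lambda>xs ys. (s * F xs ys - t * G xs ys)\<^sup>2)"
      by (rule bexp2_mono) (use p in auto)
    also have "\<dots> = bexp2 p a b (\<lambda>xs ys. s\<^sup>2 * (F xs ys)\<^sup>2 - (2 * s * t) * (F xs ys * G xs ys) + t\<^sup>2 * (G xs ys)\<^sup>2)"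
      by (rule bexp2_cong) (simp add: power2_eq_square algebra_simps)
    finally show ?thesis by (simp add: bexp2_add bexp2_diff bexp2_cmult A_def B_def C_def)
  qed
  have A0: "A \<ge> 0" and B0: "B \<ge> 0" using q[of 1 0] q[of 0 1] by auto
  show ?thesis unfolding A_def[symmetric] B_def[symmetric] C_def[symmetric]
  proof (cases "B = 0")
    case True
    have "C = 0"
    proof (rule ccontr)
      assume "C \<noteq> 0"
      with q[of 1 "(A + 1) / (2 * C)"] True show False by simp
    qed
    with A0 B0 show "C\<^sup>2 \<le> A * B" by simp
  next
    case False
    with B0 have "B > 0" by simp
    from q[of B C] have "0 \<le> B * (A * B - C\<^sup>2)" by (simp add: power2_eq_square algebra_simps)
    with \<open>B > 0\<close> show "C\<^sup>2 \<le> A * B" by (simp add: zero_le_mult_iff)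
  qed
qed

text \<open>
Jensen's inequality for the logarithm, from the tangent line of \<open>ln\<close> at \<open>c\<close>.
\<close>

lemma bexp2_ln_le:
  assumes p: "0 \<le> p" "p \<le> 1" and pos: "\<And>xs ys. F xs ys > 0" and c: "bexp2 p a b F \<le> c" "c > 0"
  shows "bexp2 p a b (\<lambda>xs ys. ln (F xs ys)) \<le> ln c"
proof -
  have "ln (F xs ys) \<le> (1 / c) * F xs ys + (ln c - 1)" for xs ys
  proof -
    have "ln (F xs ys / c) \<le> F xs ys / c - 1"
      by (rule ln_le_minus_one) (use pos c in simp)
    then show ?thesis using pos[of xs ys] c by (simp add: ln_div)
  qed
  then have "bexp2 p a b (\<lambda>xs ys. ln (F xs ys)) \<le> bexp2 p a b (\<lambda>xs ys. (1 / c) * F xs ys + (ln c - 1))"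
    by (intro bexp2_mono p)
  also have "\<dots> = (1 / c) * bexp2 p a b F + (ln c - 1)"
    by (simp only: bexp2_add bexp2_cmult bexp2_const)
  also have "\<dots> \<le> ln c" using c by simp
  finally show ?thesis .
qed

section \<open>Counting ones\<close>

definition ones :: "bool list \<Rightarrow> real" where "ones xs = real (count_list xs True)"

lemma ones_simps [simp]: "ones [] = 0" "ones (b # xs) = of_bool b + ones xs"
  by (simp_all add: ones_def)

lemma ones_nonneg: "ones xs \<ge> 0" by (simp add: ones_def)

lemma ones_eq_sum: "ones xs = (\<Sum>i<length xs. of_bool (xs ! i))"
proof (induction xs)
  case (Cons b xs)
  then show ?case
    by (simp add: sum.lessThan_Suc_shift del: sum.lessThan_Suc sum_of_bool_eq)
qed simp

lemma zeros_eq_sum: "real (length xs) - ones xs = (\<Sum>i<length xs. of_bool (\<not> xs ! i))"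
  by (simp add: ones_eq_sum of_bool_not_iff sum_subtractf del: sum_of_bool_eq)

lemma bexp_ones: "bexp p n ones = p * n"
  by (induction n) (simp_all add: bexp_add algebra_simps)

lemma bexp_ones_centered: "bexp p n (\<lambda>xs. ones xs - p * n) = 0"
  by (simp add: bexp_diff bexp_ones)

lemma bexp_ones_variance: "bexp p n (\<lambda>xs. (ones xs - p * n)\<^sup>2) = n * p * (1 - p)"
proof (induction n)
  case (Suc n)
  have *: "bexp p n (\<lambda>xs. (b + ones xs - p * Suc n)\<^sup>2) = n * p * (1 - p) + (b - p)\<^sup>2" for b :: real
  proof -
    have "bexp p n (\<lambda>xs. (b + ones xs - p * Suc n)\<^sup>2)
      = bexp p n (\<lambda>xs. (ones xs - p * n)\<^sup>2 + (2 * (b - p)) * (ones xs - p * n) + (b - p)\<^sup>2)"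
      by (rule bexp_cong) (simp add: power2_eq_square algebra_simps)
    then show ?thesis
      by (simp add: bexp_add bexp_cmult Suc bexp_ones_centered del: of_nat_Suc)
  qed
  have "bexp p (Suc n) (\<lambda>xs. (ones xs - p * Suc n)\<^sup>2)
      = p * (n * p * (1 - p) + (1 - p)\<^sup>2) + (1 - p) * (n * p * (1 - p) + (0 - p)\<^sup>2)"
    by (simp only: bexp.simps ones_simps of_bool_eq * flip: *)
  then show ?case by (simp add: power2_eq_square algebra_simps)
qed simp

text \<open>
The standard deviation is at most \<open>sqrt (p n)\<close>, which is a small fraction of the mean \<open>p n\<close> once
that is large; the constants are those used for the ones of a longest common subsequence below.
\<close>

lemma bexp_abs_ones:
  assumes p: "0 < p" "p \<le> 1" and n: "p * n \<ge> 256"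
  shows "bexp p n (\<lambda>xs. \<bar>ones xs - p * n\<bar>) \<le> p * n / 16"
proof -
  define m where "m = p * real n"
  have m: "m > 0" using n by (simp add: m_def)
  \<comment> \<open>the arithmetic-geometric mean inequality, balanced so that the linear and the quadratic term
      each contribute half of the bound when m = 256\<close>
  have am: "\<bar>v\<bar> \<le> m / 32 + 8 / m * v\<^sup>2" for v :: real
  proof -
    have "0 \<le> (\<bar>v\<bar> - m / 16)\<^sup>2" by simp
    then have "m * \<bar>v\<bar> / 8 \<le> v\<^sup>2 + m\<^sup>2 / 256" by (simp add: power2_eq_square algebra_simps)
    then show ?thesis using m by (simp add: field_simps power2_eq_square)
  qed
  have "bexp p n (\<lambda>xs. \<bar>ones xs - p * n\<bar>) \<le> bexp p n (\<lambda>xs. m / 32 + 8 / m * (ones xs - p * n)\<^sup>2)"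
    by (rule bexp_mono) (use p am in auto)
  also have "\<dots> = m / 32 + 8 / m * (n * p * (1 - p))"
    by (simp only: bexp_add bexp_cmult bexp_const bexp_ones_variance)
  also have "\<dots> \<le> m / 32 + 8"
    using m p by (simp add: m_def field_simps)
  also have "\<dots> \<le> m / 16" using n by (simp add: m_def)
  finally show ?thesis by (simp add: m_def)
qed

text \<open>
A constant word of length \<open>n\<close> has probability at least \<open>p ^ n\<close>, since \<open>p\<close> is the smaller letter probability.
\<close>

lemma bexp_ge_replicate:
  assumes "0 \<le> p" "p \<le> 1/2" "\<And>xs. F xs \<ge> 0"
  shows "p ^ n * F (replicate n b) \<le> bexp p n F"
  using assms(3)
proof (induction n arbitrary: F)
  case (Suc n)
  have nn: "0 \<le> bexp p n (\<lambda>xs. F (c # xs))" for c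
    using bexp_mono[of p n "\<lambda>_. 0" "\<lambda>xs. F (c # xs)"] assms Suc.prems by simp
  have IH: "p ^ n * F (b # replicate n b) \<le> bexp p n (\<lambda>xs. F (b # xs))"
    by (rule Suc.IH) (rule Suc.prems)
  have "p ^ Suc n * F (replicate (Suc n) b) \<le> p * bexp p n (\<lambda>xs. F (b # xs))"
    using mult_left_mono[OF IH assms(1)] by (simp add: mult.assoc)
  also have "\<dots> \<le> bexp p (Suc n) F"
  proof (cases b)
    case False
    have "p * bexp p n (\<lambda>xs. F (False # xs)) \<le> (1 - p) * bexp p n (\<lambda>xs. F (False # xs))"
      by (rule mult_right_mono) (use assms nn in auto)
    then show ?thesis using False assms nn[of True] by (simp add: add_increasing)
  qed (use assms nn in simp)
  finally show ?case .
qed simp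

section \<open>Longest common subsequences of words\<close>

definition lcs :: "'a list \<Rightarrow> 'a list \<Rightarrow> nat" where
  "lcs xs ys = Max {length zs | zs. subseq zs xs \<and> subseq zs ys}"

lemma finite_common_lengths: "finite {length zs | zs. subseq zs xs \<and> subseq zs ys}"
  by (rule finite_subset[of _ "{..length xs}"]) (auto dest: list_emb_length)

lemma lcs_ge: "subseq zs xs \<Longrightarrow> subseq zs ys \<Longrightarrow> length zs \<le> lcs xs ys"
  unfolding lcs_def by (rule Max_ge[OF finite_common_lengths]) auto

lemma lcs_attained: "\<exists>zs. subseq zs xs \<and> subseq zs ys \<and> length zs = lcs xs ys"
proof -
  have "{length zs | zs. subseq zs xs \<and> subseq zs ys} \<noteq> {}"
    by (auto intro!: exI[of _ "[]"])
  from Max_in[OF finite_common_lengths this] show ?thesis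
    unfolding lcs_def by auto
qed

text \<open>
A choice is fixed so that the number of ones in an optimal common subsequence becomes a function of the two words.
\<close>

definition opt_subseq :: "'a list \<Rightarrow> 'a list \<Rightarrow> 'a list" where
  "opt_subseq xs ys = (SOME zs. subseq zs xs \<and> subseq zs ys \<and> length zs = lcs xs ys)"

lemma opt_subseq: "subseq (opt_subseq xs ys) xs" "subseq (opt_subseq xs ys) ys" "length (opt_subseq xs ys) = lcs xs ys"
  using someI_ex[OF lcs_attained[of xs ys]] by (simp_all add: opt_subseq_def)

lemma lcs_le_length: "lcs xs ys \<le> length xs"
  using list_emb_length[OF opt_subseq(1)[of xs ys]] by (simp add: opt_subseq(3))

lemma lcs_mono:
  assumes "subseq xs xs'" "subseq ys ys'"
  shows "lcs xs ys \<le> lcs xs' ys'"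
  using lcs_ge[OF subseq_order.order_trans[OF opt_subseq(1) assms(1)] subseq_order.order_trans[OF opt_subseq(2) assms(2)]]
  by (simp add: opt_subseq(3))

lemma lcs_Cons_same: "Suc (lcs xs ys) \<le> lcs (x # xs) (x # ys)"
  using lcs_ge[of "x # opt_subseq xs ys" "x # xs" "x # ys"] opt_subseq[of xs ys] by simp

lemma subseq_insert_at: "subseq xs (insert_at i s xs)"
proof -
  have "subseq (take i xs @ drop i xs) (take i xs @ s # drop i xs)"
    by (intro list_emb_append_mono) auto
  then show ?thesis by (simp add: insert_at_def)
qed

lemma subseq_delete_at_all_but_one:
  assumes "subseq zs xs"
  obtains zs' where "subseq zs' zs" "subseq zs' (delete_at i xs)" "length zs \<le> Suc (length zs')"
proof (cases "i < length xs")
  case True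
  from assms obtain z1 z2 where z: "zs = z1 @ z2" "subseq z1 (take i xs)" "subseq z2 (xs ! i # drop (Suc i) xs)"
    by (subst (asm) (2) id_take_nth_drop[OF True]) (auto simp: subseq_append_iff)
  from z(3) have "\<exists>z3. subseq z3 z2 \<and> subseq z3 (drop (Suc i) xs) \<and> length z2 \<le> Suc (length z3)"
    by (cases rule: list_emb.cases) auto
  then obtain z3 where "subseq z3 z2" "subseq z3 (drop (Suc i) xs)" "length z2 \<le> Suc (length z3)"
    by blast
  with z that[of "z1 @ z3"] show ?thesis
    by (auto simp: delete_at_def intro: list_emb_append_mono)
next
  case False
  with assms that[of zs] show ?thesis by (simp add: delete_at_def)
qed

lemma lcs_insert_at_le:
  assumes "i \<le> length xs" "j \<le> length ys"
  shows "lcs (insert_at i s xs) (insert_at j t ys) \<le> lcs xs ys + 2"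
proof -
  let ?X = "insert_at i s xs" and ?Y = "insert_at j t ys"
  obtain z1 where z1: "subseq z1 (opt_subseq ?X ?Y)" "subseq z1 xs" "lcs ?X ?Y \<le> Suc (length z1)"
    using subseq_delete_at_all_but_one[OF opt_subseq(1), of ?X ?Y i] delete_at_insert_at[OF assms(1)] by (metis opt_subseq(3))
  have "subseq z1 ?Y" using z1 opt_subseq(2) subseq_order.order_trans by blast
  then obtain z2 where z2: "subseq z2 z1" "subseq z2 ys" "length z1 \<le> Suc (length z2)"
    using subseq_delete_at_all_but_one[of z1 ?Y j] delete_at_insert_at[OF assms(2)] by metis
  have "length z2 \<le> lcs xs ys"
    using z1 z2 subseq_order.order_trans by (blast intro: lcs_ge)
  with z1 z2 show ?thesis by simp
qed

text \<open>
Every embedding of \<open>zs\<close> into \<open>xs\<close> uses position \<open>i\<close>.  Stating this through deletion avoids the choice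
of an embedding, and it is all that is needed to bound the loss caused by a deletion.
\<close>

definition essential :: "'a list \<Rightarrow> 'a list \<Rightarrow> nat \<Rightarrow> bool" where
  "essential zs xs i \<longleftrightarrow> \<not> subseq zs (delete_at i xs)"

text \<open>
Deleting a letter costs nothing if \<open>zs\<close> can be embedded without it, and at most one letter of \<open>zs\<close> otherwise; the
losses in the two words add up because a subsequence of \<open>zs\<close> remains a subsequence of the other word.
\<close>

lemma lcs_delete_at_ge:
  assumes "subseq zs xs" "subseq zs ys"
  shows "length zs \<le> lcs (delete_at i xs) (delete_at j ys) + of_bool (essential zs xs i) + of_bool (essential zs ys j)"
proof -
  obtain z1 where z1: "subseq z1 zs" "subseq z1 (delete_at i xs)" "length zs \<le> length z1 + of_bool (essential zs xs i)"
  proof (cases "essential zs xs i")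
    case True
    with subseq_delete_at_all_but_one[OF assms(1), of i] that show ?thesis by auto
  qed (use that[of zs] in \<open>auto simp: essential_def\<close>)
  obtain z2 where z2: "subseq z2 z1" "subseq z2 (delete_at j ys)" "length z1 \<le> length z2 + of_bool (essential zs ys j)"
  proof (cases "essential zs ys j")
    case True
    have "subseq z1 ys" using z1(1) assms(2) subseq_order.order_trans by blast
    from subseq_delete_at_all_but_one[OF this, of j] True that show ?thesis by auto
  next
    case False
    then have "subseq z1 (delete_at j ys)"
      using z1(1) subseq_order.order_trans unfolding essential_def by blast
    with False that[of z1] show ?thesis by auto
  qed
  have "length z2 \<le> lcs (delete_at i xs) (delete_at j ys)"
    using z1 z2 subseq_order.order_trans by (blast intro: lcs_ge)
  with z1 z2 show ?thesis by linarith
qed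

text \<open>
Every embedding uses only as many ones of \<open>xs\<close> as \<open>zs\<close> contains, and essential positions belong to all
embeddings.
\<close>

lemma essential_True_le_ones:
  assumes "subseq zs xs"
  shows "(\<Sum>i<length xs. of_bool (xs ! i \<and> essential zs xs i)) \<le> ones zs"
  using assms
proof (induction rule: list_emb.induct)
  case (list_emb_Nil xs)
  then show ?case by (simp add: essential_def)
next
  case (list_emb_Cons zs xs x)
  have "(\<Sum>i<length xs. of_bool (xs ! i \<and> essential zs (x # xs) (Suc i)))
      \<le> (\<Sum>i<length xs. of_bool (xs ! i \<and> essential zs xs i) :: real)"
    by (rule sum_mono) (auto simp: essential_def delete_at_def)
  moreover have "\<not> essential zs (x # xs) 0"
    using list_emb_Cons.hyps by (simp add: essential_def delete_at_def)
  ultimately show ?case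
    using list_emb_Cons.IH
    by (simp add: sum.lessThan_Suc_shift del: sum.lessThan_Suc sum_of_bool_eq)
next
  case (list_emb_Cons2 z x zs xs)
  have "(\<Sum>i<length xs. of_bool (xs ! i \<and> essential (z # zs) (x # xs) (Suc i)))
      \<le> (\<Sum>i<length xs. of_bool (xs ! i \<and> essential zs xs i) :: real)"
    by (rule sum_mono) (use list_emb_Cons2.hyps in \<open>auto simp: essential_def delete_at_def\<close>)
  moreover have "of_bool (x \<and> essential (z # zs) (x # xs) 0) \<le> (of_bool z :: real)"
    using list_emb_Cons2.hyps by auto
  moreover have "(\<Sum>i<length (x # xs). of_bool ((x # xs) ! i \<and> essential (z # zs) (x # xs) i))
      = of_bool (x \<and> essential (z # zs) (x # xs) 0)
        + (\<Sum>i<length xs. of_bool (xs ! i \<and> essential (z # zs) (x # xs) (Suc i)) :: real)"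
    by (simp only: list.size sum.lessThan_Suc_shift add_Suc_right add_0_right nth_Cons_0 nth_Cons_Suc)
  ultimately show ?case
    using list_emb_Cons2.IH unfolding ones_simps by linarith
qed

lemma ones_subseq: "subseq zs xs \<Longrightarrow> ones zs \<le> ones xs"
  by (induction rule: list_emb.induct) (auto simp: ones_nonneg)

lemma subseq_replicate_False: "k + count_list xs True \<le> length xs \<Longrightarrow> subseq (replicate k False) xs"
proof (induction xs arbitrary: k)
  case (Cons x xs)
  show ?case
  proof (cases "k = 0 \<or> x")
    case True
    with Cons show ?thesis by (cases "k = 0") auto
  next
    case False
    with Cons show ?thesis by (cases k) auto
  qed
qed simp

text \<open>
The zeros alone form a common subsequence, limited by the word with fewer zeros.
\<close>

lemma lcs_ge_length_minus_ones:
  assumes "length xs = m" "length ys = m"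
  shows "real (lcs xs ys) \<ge> m - (ones xs + ones ys)"
proof -
  define k where "k = m - (count_list xs True + count_list ys True)"
  have "k = 0 \<or> k + count_list xs True \<le> m \<and> k + count_list ys True \<le> m"
    by (auto simp: k_def)
  then have "subseq (replicate k False) xs" "subseq (replicate k False) ys"
    using assms by (auto intro: subseq_replicate_False)
  from lcs_ge[OF this] have "k \<le> lcs xs ys" by simp
  then show ?thesis by (simp add: k_def ones_def)
qed

section \<open>A weighted count of matchings of ones\<close>

text \<open>
The sum of the weights of all matchings of at most \<open>k\<close> ones of \<open>xs\<close> with ones of \<open>ys\<close>, in increasing order.  A
matching \<open>(i\<^sub>1, j\<^sub>1), (i\<^sub>2, j\<^sub>2), \<dots>\<close> has weight \<open>\<mu>\<close> for each pair times \<open>1/2\<close> for each unit of total variation of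
the shift \<open>i - j\<close>.  The recursion is on the first pair \<open>(i, j)\<close>, after which the words start afresh behind it.
\<close>

primrec match_weight :: "real \<Rightarrow> nat \<Rightarrow> bool list \<Rightarrow> bool list \<Rightarrow> real" where
  "match_weight \<mu> 0 xs ys = 1"
| "match_weight \<mu> (Suc k) xs ys = 1 + (\<Sum>i<length xs. \<Sum>j<length ys.
     of_bool (xs ! i \<and> ys ! j) * (\<mu> * (1/2) ^ ((i - j) + (j - i)) * match_weight \<mu> k (drop (Suc i) xs) (drop (Suc j) ys)))"

lemma match_weight_ge_1: "\<mu> \<ge> 0 \<Longrightarrow> match_weight \<mu> k xs ys \<ge> 1"
proof (induction k arbitrary: xs ys)
  case (Suc k)
  have "match_weight \<mu> k xs ys \<ge> 0" for xs ys using Suc.IH[of xs ys] Suc.prems by simp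
  then show ?case using Suc.prems by (auto intro!: sum_nonneg)
qed simp

text \<open>
The ones of a common subsequence \<open>zs\<close> determine one of the matchings.  Between consecutive matched ones the shift
changes by the difference of the two gap lengths, and at least that many letters are unmatched
there; so the total variation of the shift is at most the number of unmatched letters, the exponent of \<open>1/2\<close>.
\<close>

lemma match_weight_ge:
  assumes "\<mu> \<ge> 0" "subseq zs xs" "subseq zs ys" "count_list zs True \<le> k"
  shows "\<mu> ^ count_list zs True * (1/2) ^ (length xs + length ys - 2 * length zs) \<le> match_weight \<mu> k xs ys"
  using assms(2-)
proof (induction k arbitrary: xs ys zs)
  case 0
  then show ?case by (simp add: power_le_one)
next
  case (Suc k)
  show ?case
  proof (cases "True \<in> set zs")
    case False
    then have "count_list zs True = 0" by (simp add: count_list_0_iff)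
    then have "\<mu> ^ count_list zs True * (1/2) ^ (length xs + length ys - 2 * length zs) \<le> 1"
      by (simp add: power_le_one)
    also have "1 \<le> match_weight \<mu> (Suc k) xs ys" by (rule match_weight_ge_1[OF assms(1)])
    finally show ?thesis .
  next
    case True
    then obtain z1 z2 where z: "zs = z1 @ True # z2" "True \<notin> set z1"
      by (meson split_list_first)
    then have cz: "count_list zs True = Suc (count_list z2 True)"
      by (simp add: count_list_0_iff)
    have split: "\<exists>i<length ws. length z1 \<le> i \<and> ws ! i \<and> subseq z2 (drop (Suc i) ws)" if sub: "subseq zs ws" for ws
    proof -
      from sub obtain w1 w2 where w: "ws = w1 @ w2" "subseq z1 w1" "subseq (True # z2) w2"
        unfolding z by (blast dest: list_emb_appendD)
      from list_emb_ConsD[OF w(3)] obtain w3 w4 where w': "w2 = w3 @ True # w4" "subseq z2 w4"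
        by auto
      show ?thesis
        by (rule exI[of _ "length w1 + length w3"])
          (use w w' list_emb_length[OF w(2)] in \<open>auto simp: nth_append\<close>)
    qed
    from split[OF Suc.prems(1)] obtain i where i: "i < length xs" "length z1 \<le> i" "xs ! i" "subseq z2 (drop (Suc i) xs)" by auto
    from split[OF Suc.prems(2)] obtain j where j: "j < length ys" "length z1 \<le> j" "ys ! j" "subseq z2 (drop (Suc j) ys)" by auto
    let ?d = "(i - j) + (j - i)" and ?U = "length (drop (Suc i) xs) + length (drop (Suc j) ys) - 2 * length z2"
    let ?t = "\<lambda>i j. of_bool (xs ! i \<and> ys ! j) * (\<mu> * (1/2) ^ ((i - j) + (j - i)) * match_weight \<mu> k (drop (Suc i) xs) (drop (Suc j) ys))"
    have t0: "0 \<le> ?t i j" for i j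
      using assms(1) order_trans[OF zero_le_one match_weight_ge_1[OF assms(1)]] by (intro mult_nonneg_nonneg) auto
    \<comment> \<open>the skipped letters before the pair (i, j) number at least the distance of i and j, since both gaps
        contain the word z1\<close>
    have U: "?d + ?U \<le> length xs + length ys - 2 * length zs"
      using i j list_emb_length[OF i(4)] list_emb_length[OF j(4)] unfolding z by (simp; linarith)
    have "\<mu> ^ count_list zs True * (1/2) ^ (length xs + length ys - 2 * length zs)
        \<le> \<mu> ^ count_list zs True * (1/2) ^ (?d + ?U)"
      using assms(1) by (intro mult_left_mono power_decreasing U) auto
    also have "\<dots> = \<mu> * (1/2) ^ ?d * (\<mu> ^ count_list z2 True * (1/2) ^ ?U)"
      by (simp add: cz power_add)
    also have "\<dots> \<le> \<mu> * (1/2) ^ ?d * match_weight \<mu> k (drop (Suc i) xs) (drop (Suc j) ys)"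
      using assms(1) Suc.prems(3) by (intro mult_left_mono Suc.IH i j) (auto simp: cz)
    also have "\<dots> = ?t i j" using i j by simp
    also have "\<dots> \<le> (\<Sum>j<length ys. ?t i j)"
      using j by (intro member_le_sum t0) auto
    also have "\<dots> \<le> (\<Sum>i<length xs. \<Sum>j<length ys. ?t i j)"
      using i by (intro member_le_sum[of i _ "\<lambda>i. \<Sum>j<length ys. ?t i j"] sum_nonneg t0) auto
    also have "\<dots> \<le> match_weight \<mu> (Suc k) xs ys" by simp
    finally show ?thesis .
  qed
qed

text \<open>
Two geometric series, one on either side of \<open>i\<close>, with sums at most 2 and 1.
\<close>

lemma sum_half_power_distance: "(\<Sum>j<n. (1/2::real) ^ ((i - j) + (j - i))) \<le> 3"
proof -
  have "(\<Sum>j<n. (1/2::real) ^ ((i - j) + (j - i)))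
     \<le> (if n \<le> Suc i then 2 * (1/2) ^ (Suc i - n) else 3 - (1/2) ^ (n - Suc i))"
  proof (induction n)
    case (Suc n)
    consider "Suc n \<le> i" | "n = i" | "n > i" by linarith
    then show ?case
    proof cases
      case 1
      then obtain d where "i = Suc n + d" using le_Suc_ex by blast
      with Suc show ?thesis by simp
    next
      case 2
      with Suc show ?thesis by simp
    next
      case 3
      then obtain d where "n = Suc i + d" using Suc_le_eq le_Suc_ex by metis
      with Suc show ?thesis by (auto simp: field_simps split: if_splits)
    qed
  qed simp
  also have "\<dots> \<le> 3"
    by (auto intro: order_trans[of _ "2 * 1"] simp: power_le_one)
  finally show ?thesis .
qed

lemma bexp2_restrict_drop:
  assumes "i < a" "j < b"
  shows "bexp2 p a b (\<lambda>xs ys. of_bool (xs ! i \<and> ys ! j) * F (drop (Suc i) xs) (drop (Suc j) ys))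
    = p\<^sup>2 * bexp2 p (a - Suc i) (b - Suc j) F"
proof -
  define a' b' where "a' = a - 1" and "b' = b - 1"
  then have ab: "a = Suc a'" "b = Suc b'" and ij: "i \<le> a'" "j \<le> b'" using assms by auto
  have "bexp2 p a b (\<lambda>xs ys. of_bool (xs ! i = True \<and> ys ! j = True) * F (drop (Suc i) xs) (drop (Suc j) ys))
      = p\<^sup>2 * bexp2 p a' b' (\<lambda>xs ys. F (drop (Suc i) (insert_at i True xs)) (drop (Suc j) (insert_at j True ys)))"
    using bexp2_restrict_nth[OF ij, of p True True "\<lambda>xs ys. F (drop (Suc i) xs) (drop (Suc j) ys)"]
    unfolding ab by (simp only: bern_weight_def power2_eq_square if_True)
  also have "bexp2 p a' b' (\<lambda>xs ys. F (drop (Suc i) (insert_at i True xs)) (drop (Suc j) (insert_at j True ys)))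
    = bexp2 p a' b' (\<lambda>xs ys. F (drop i xs) (drop j ys))"
    by (rule bexp2_cong) (use ij in \<open>simp add: insert_at_def\<close>)
  also have "\<dots> = bexp2 p (a' - i) (b' - j) F"
    unfolding bexp2_def bexp_drop[OF ij(2)] by (rule bexp_drop[OF ij(1)])
  finally show ?thesis by (simp add: ab)
qed

lemma sum_geometric_reverse: "(\<Sum>i<a. c * (1 + c) ^ (a - Suc i)) = (1 + c) ^ a - (1::real)"
proof -
  have "(\<Sum>i<a. c * (1 + c) ^ (a - Suc i)) = (\<Sum>i<a. c * (1 + c) ^ i)"
    by (rule sum.nat_diff_reindex)
  also have "\<dots> = (1 + c) ^ a - 1"
    by (induction a) (simp_all add: algebra_simps)
  finally show ?thesis .
qed

text \<open>
A pair of matched ones contributes the factor \<open>p\<^sup>2 \<mu>\<close>, and the sum over its second position \<open>j\<close> the factor 3.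
The remaining sum over subsets of positions of the first word is the binomial expansion of the right-hand side.
\<close>

lemma bexp2_match_weight_le:
  assumes p: "0 \<le> p" "p \<le> 1" and \<mu>: "\<mu> \<ge> 0"
  shows "bexp2 p a b (match_weight \<mu> k) \<le> (1 + 3 * p\<^sup>2 * \<mu>) ^ a"
proof (induction k arbitrary: a b)
  case 0
  have "bexp2 p a b (match_weight \<mu> 0) = bexp2 p a b (\<lambda>_ _. 1)" by (rule bexp2_cong) simp
  then show ?case using p \<mu> by simp
next
  case (Suc k)
  let ?c = "3 * p\<^sup>2 * \<mu>"
  let ?d = "\<lambda>i j. (i - j) + (j - i) :: nat"
  have "bexp2 p a b (match_weight \<mu> (Suc k)) = bexp2 p a b (\<lambda>xs ys. 1 + (\<Sum>i<a. \<Sum>j<b.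
     \<mu> * (1/2) ^ ?d i j * (of_bool (xs ! i \<and> ys ! j) * match_weight \<mu> k (drop (Suc i) xs) (drop (Suc j) ys))))"
    by (rule bexp2_cong) (simp add: mult_ac)
  also have "\<dots> = 1 + (\<Sum>i<a. \<Sum>j<b. \<mu> * (1/2) ^ ?d i j *
      bexp2 p a b (\<lambda>xs ys. of_bool (xs ! i \<and> ys ! j) * match_weight \<mu> k (drop (Suc i) xs) (drop (Suc j) ys)))"
    by (simp only: bexp2_add bexp2_const bexp2_sum bexp2_cmult)
  also have "\<dots> = 1 + (\<Sum>i<a. \<Sum>j<b. \<mu> * (1/2) ^ ?d i j * (p\<^sup>2 * bexp2 p (a - Suc i) (b - Suc j) (match_weight \<mu> k)))"
  proof (intro arg_cong2[of _ _ _ _ "(+)"] arg_cong2[of _ _ _ _ "(*)"] refl sum.cong)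
    fix i j assume "i \<in> {..<a}" "j \<in> {..<b}"
    then show "bexp2 p a b (\<lambda>xs ys. of_bool (xs ! i \<and> ys ! j) * match_weight \<mu> k (drop (Suc i) xs) (drop (Suc j) ys))
        = p\<^sup>2 * bexp2 p (a - Suc i) (b - Suc j) (match_weight \<mu> k)"
      using bexp2_restrict_drop[of i a j b p "match_weight \<mu> k"] by simp
  qed
  also have "\<dots> \<le> 1 + (\<Sum>i<a. \<Sum>j<b. \<mu> * (1/2) ^ ?d i j * (p\<^sup>2 * (1 + ?c) ^ (a - Suc i)))"
    using \<mu> by (intro add_mono sum_mono mult_left_mono Suc.IH) auto
  also have "\<dots> = 1 + (\<Sum>i<a. (\<mu> * p\<^sup>2 * (1 + ?c) ^ (a - Suc i)) * (\<Sum>j<b. (1/2) ^ ?d i j))"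
    unfolding sum_distrib_left by (simp only: mult_ac)
  also have "\<dots> \<le> 1 + (\<Sum>i<a. (\<mu> * p\<^sup>2 * (1 + ?c) ^ (a - Suc i)) * 3)"
    using \<mu> by (intro add_mono sum_mono mult_left_mono sum_half_power_distance) auto
  also have "\<dots> = 1 + (\<Sum>i<a. ?c * (1 + ?c) ^ (a - Suc i))"
    by (simp add: mult_ac)
  also have "\<dots> = (1 + ?c) ^ a" by (simp add: sum_geometric_reverse)
  finally show ?case .
qed

section \<open>Few ones are matched\<close>

text \<open>
Each matched one gains \<open>ln (1 / p)\<close> in the logarithm of \<open>match_weight\<close>, whose expectation is of order \<open>p m\<close>
only.  The factors \<open>1/2\<close> cost at most \<open>ln 2 \<le> 1\<close> for each unmatched letter, and comparison with the zeros
shows that there are at most twice as many of these as there are ones.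
\<close>

lemma expected_opt_subseq_ones_le:
  assumes p: "0 < p" "p < 1"
  shows "bexp2 p m m (\<lambda>xs ys. ones (opt_subseq xs ys)) * ln (1 / p) \<le> 7 * (p * m)"
proof -
  have ptw: "ones (opt_subseq xs ys) * ln (1 / p) \<le> ln (match_weight (1 / p) m xs ys) + 2 * (ones xs + ones ys)"
    if len: "length xs = m" "length ys = m" for xs ys
  proof -
    let ?z = "opt_subseq xs ys"
    let ?U = "length xs + length ys - 2 * length ?z"
    have "(1 / p) ^ count_list ?z True * (1/2) ^ ?U \<le> match_weight (1 / p) m xs ys"
      using p opt_subseq(1,2)[of xs ys] count_le_length[of ?z True] lcs_le_length[of xs ys] len opt_subseq(3)[of xs ys]
      by (intro match_weight_ge) auto
    then have "ln ((1 / p) ^ count_list ?z True * (1/2) ^ ?U) \<le> ln (match_weight (1 / p) m xs ys)"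
      using p by (subst ln_le_cancel_iff) (auto intro!: mult_pos_pos less_le_trans[OF _ match_weight_ge_1])
    moreover have "ln ((1 / p) ^ count_list ?z True * (1/2) ^ ?U) = ones ?z * ln (1 / p) - ?U * ln 2"
      using p by (simp add: ln_mult ln_realpow ones_def ln_div)
    moreover have "real ?U \<le> 2 * (ones xs + ones ys)"
      using lcs_ge_length_minus_ones[OF len] lcs_le_length[of xs ys] len
      by (simp add: opt_subseq(3))
    moreover have "?U * ln 2 \<le> real ?U * 1"
      using ln_2_less_1 by (intro mult_left_mono) auto
    ultimately show ?thesis by linarith
  qed
  have "bexp2 p m m (\<lambda>xs ys. ones (opt_subseq xs ys)) * ln (1 / p)
      = bexp2 p m m (\<lambda>xs ys. ln (1 / p) * ones (opt_subseq xs ys))"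
    unfolding bexp2_cmult by (rule mult.commute)
  also have "\<dots> \<le> bexp2 p m m (\<lambda>xs ys. ln (match_weight (1 / p) m xs ys) + 2 * (ones xs + ones ys))"
    by (rule bexp2_mono) (use p ptw in \<open>auto simp: mult.commute\<close>)
  also have "\<dots> = bexp2 p m m (\<lambda>xs ys. ln (match_weight (1 / p) m xs ys)) + 4 * (p * m)"
    by (simp only: bexp2_add bexp2_cmult bexp2_left bexp2_right bexp_ones) simp
  also have "bexp2 p m m (\<lambda>xs ys. ln (match_weight (1 / p) m xs ys)) \<le> ln ((1 + 3 * p) ^ m)"
  proof (rule bexp2_ln_le)
    show "bexp2 p m m (\<lambda>xs ys. match_weight (1 / p) m xs ys) \<le> (1 + 3 * p) ^ m"
      using bexp2_match_weight_le[of p "1 / p" m m m] p by (simp add: power2_eq_square)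
  qed (use p in \<open>auto intro!: less_le_trans[OF _ match_weight_ge_1]\<close>)
  also have "ln ((1 + 3 * p) ^ m) \<le> 3 * (p * m)"
  proof -
    have "ln ((1 + 3 * p) ^ m) = m * ln (1 + 3 * p)"
      using p by (simp add: ln_realpow)
    also have "\<dots> \<le> m * (3 * p)"
      using p by (intro mult_left_mono ln_add_one_self_le_self) auto
    finally show ?thesis by (simp add: mult_ac)
  qed
  finally show ?thesis by simp
qed

text \<open>
The ones inserted in \<open>sum_mean_ins_True_True_le\<close> are paired with all ones of the other word, so the number \<open>K\<close> of
matched ones appears multiplied by a number of ones \<open>N\<close>.  The latter is replaced by its mean; since \<open>K\<close> is at most
the number of ones in the word independent of \<open>N\<close>, the error is a product of independent factors.
\<close>

lemma expected_opt_subseq_ones_times_ones_le: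
  assumes p: "0 < p" "p \<le> exp (-56)" and m: "p * m \<ge> 256"
  shows "bexp2 p m m (\<lambda>xs ys. ones (opt_subseq xs ys) * ones ys) \<le> 3 / 16 * (p * m)\<^sup>2"
    and "bexp2 p m m (\<lambda>xs ys. ones (opt_subseq xs ys) * ones xs) \<le> 3 / 16 * (p * m)\<^sup>2"
proof -
  have "p < 1" using p(2) by (rule le_less_trans) simp
  have "exp 56 \<le> 1 / p" using p by (simp add: exp_minus field_simps)
  then have "ln (1 / p) \<ge> 56" using p by (subst ln_ge_iff) auto
  then have "bexp2 p m m (\<lambda>xs ys. ones (opt_subseq xs ys)) * 56 \<le> bexp2 p m m (\<lambda>xs ys. ones (opt_subseq xs ys)) * ln (1 / p)"
    using bexp2_mono[of p m m "\<lambda>_ _. 0" "\<lambda>xs ys. ones (opt_subseq xs ys)"] p \<open>p < 1\<close>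
    by (intro mult_left_mono) (auto simp: ones_nonneg)
  with expected_opt_subseq_ones_le[OF p(1) \<open>p < 1\<close>, of m]
  have K: "bexp2 p m m (\<lambda>xs ys. ones (opt_subseq xs ys)) \<le> p * m / 8" by simp
  have abs: "bexp p m (\<lambda>xs. \<bar>ones xs - p * m\<bar>) \<le> p * m / 16"
    using bexp_abs_ones[of p m] p \<open>p < 1\<close> m by simp
  \<comment> \<open>the number b of ones is replaced by its mean; the error is controlled by the ones a of the other word\<close>
  have ptw: "ones (opt_subseq xs ys) * b \<le> (p * m) * ones (opt_subseq xs ys) + a * \<bar>b - p * m\<bar>"
    if "ones (opt_subseq xs ys) \<le> a" for xs ys a b
  proof -
    have "ones (opt_subseq xs ys) * (b - p * m) \<le> a * \<bar>b - p * m\<bar>"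
      using that ones_nonneg[of "opt_subseq xs ys"]
      by (intro order_trans[OF mult_left_mono[OF abs_ge_self] mult_right_mono]) auto
    then show ?thesis by (simp add: algebra_simps)
  qed
  have "bexp2 p m m (\<lambda>xs ys. ones (opt_subseq xs ys) * ones ys)
      \<le> bexp2 p m m (\<lambda>xs ys. (p * m) * ones (opt_subseq xs ys) + ones xs * \<bar>ones ys - p * m\<bar>)"
    using p \<open>p < 1\<close> by (intro bexp2_mono ptw ones_subseq opt_subseq) auto
  also have "\<dots> = (p * m) * bexp2 p m m (\<lambda>xs ys. ones (opt_subseq xs ys)) + (p * m) * bexp p m (\<lambda>xs. \<bar>ones xs - p * m\<bar>)"
    by (simp only: bexp2_add bexp2_cmult bexp2_prod bexp_ones)
  also have "\<dots> \<le> (p * m) * (p * m / 8) + (p * m) * (p * m / 16)"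
    using p K abs by (intro add_mono mult_left_mono) auto
  also have "\<dots> = 3 / 16 * (p * m)\<^sup>2"
    by (simp add: power2_eq_square algebra_simps)
  finally show "bexp2 p m m (\<lambda>xs ys. ones (opt_subseq xs ys) * ones ys) \<le> 3 / 16 * (p * m)\<^sup>2" .
  have "bexp2 p m m (\<lambda>xs ys. ones (opt_subseq xs ys) * ones xs)
      \<le> bexp2 p m m (\<lambda>xs ys. (p * m) * ones (opt_subseq xs ys) + \<bar>ones xs - p * m\<bar> * ones ys)"
  proof (rule bexp2_mono)
    fix xs ys :: "bool list"
    show "ones (opt_subseq xs ys) * ones xs \<le> p * m * ones (opt_subseq xs ys) + \<bar>ones xs - p * m\<bar> * ones ys"
      using ptw[of xs ys "ones ys" "ones xs"] ones_subseq[OF opt_subseq(2)] by (simp add: mult.commute)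
  qed (use p \<open>p < 1\<close> in auto)
  also have "\<dots> = (p * m) * bexp2 p m m (\<lambda>xs ys. ones (opt_subseq xs ys)) + bexp p m (\<lambda>xs. \<bar>ones xs - p * m\<bar>) * (p * m)"
    by (simp only: bexp2_add bexp2_cmult bexp2_prod bexp_ones)
  also have "\<dots> \<le> (p * m) * (p * m / 8) + (p * m / 16) * (p * m)"
    using p K abs by (intro add_mono mult_left_mono mult_right_mono) auto
  also have "\<dots> = 3 / 16 * (p * m)\<^sup>2"
    by (simp add: power2_eq_square algebra_simps)
  finally show "bexp2 p m m (\<lambda>xs ys. ones (opt_subseq xs ys) * ones xs) \<le> 3 / 16 * (p * m)\<^sup>2" .
qed

section \<open>Inserting one letter into each word\<close>

definition mean_lcs :: "real \<Rightarrow> nat \<Rightarrow> real" where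
  "mean_lcs p n = bexp2 p n n (\<lambda>xs ys. real (lcs xs ys))"

definition mean_ins :: "real \<Rightarrow> nat \<Rightarrow> nat \<Rightarrow> nat \<Rightarrow> bool \<Rightarrow> bool \<Rightarrow> real" where
  "mean_ins p n i j s t = bexp2 p n n (\<lambda>xs ys. real (lcs (insert_at i s xs) (insert_at j t ys)))"

text \<open>
Two equal letters in front of the words add 1 to the longest common subsequence, and two zeros
appear there with probability \<open>(1 - p)\<^sup>2\<close>.
\<close>

lemma mean_lcs_Suc_ge:
  assumes "0 \<le> p" "p \<le> 1"
  shows "mean_lcs p n + (1 - p)\<^sup>2 \<le> mean_lcs p (Suc n)"
proof -
  have *: "mean_lcs p n + of_bool (s = t) \<le> mean_ins p n 0 0 s t" for s t
  proof -
    have "mean_lcs p n + of_bool (s = t) = bexp2 p n n (\<lambda>xs ys. real (lcs xs ys) + of_bool (s = t))"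
      by (simp only: bexp2_add bexp2_const mean_lcs_def)
    also have "\<dots> \<le> mean_ins p n 0 0 s t"
      unfolding mean_ins_def
    proof (rule bexp2_mono)
      fix xs ys :: "bool list"
      show "real (lcs xs ys) + of_bool (s = t) \<le> real (lcs (insert_at 0 s xs) (insert_at 0 t ys))"
        using lcs_Cons_same[of xs ys s] lcs_mono[OF subseq_insert_at subseq_insert_at, of xs ys 0 s 0 t]
        by (auto simp: insert_at_def)
    qed (use assms in auto)
    finally show ?thesis .
  qed
  have "mean_lcs p n + (1 - p)\<^sup>2 \<le> (\<Sum>s\<in>UNIV. \<Sum>t\<in>UNIV. bern_weight p s * bern_weight p t * (mean_lcs p n + of_bool (s = t)))"
    using assms by (simp add: UNIV_bool bern_weight_def power2_eq_square algebra_simps)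
  also have "\<dots> \<le> (\<Sum>s\<in>UNIV. \<Sum>t\<in>UNIV. bern_weight p s * bern_weight p t * mean_ins p n 0 0 s t)"
    using assms by (intro sum_mono mult_left_mono *) (auto simp: bern_weight_def)
  also have "\<dots> = mean_lcs p (Suc n)"
    unfolding mean_lcs_def mean_ins_def by (rule bexp2_insert_at[symmetric]) simp_all
  finally show ?thesis .
qed

text \<open>
Inserting independent random letters at \<open>i\<close> and \<open>j\<close> produces words of length \<open>n + 1\<close>, whose mean is known to be large.
Insertions other than two zeros have probability about \<open>2 p\<close> and contribute at most \<open>2\<close> each, so the
increase must come from the two zeros.
\<close>

lemma mean_ins_False_False_ge:
  assumes p: "0 \<le> p" "p \<le> 1/8" and ij: "i \<le> n" "j \<le> n"
  shows "mean_lcs p n + 1 - 6 * p \<le> mean_ins p n i j False False"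
proof -
  have up: "mean_ins p n i j s t \<le> mean_lcs p n + 2" for s t
  proof -
    have "mean_ins p n i j s t \<le> bexp2 p n n (\<lambda>xs ys. real (lcs xs ys) + 2)"
      unfolding mean_ins_def
    proof (rule bexp2_mono)
      fix xs ys :: "bool list" assume "length xs = n" "length ys = n"
      with ij lcs_insert_at_le[of i xs j ys s t]
      show "real (lcs (insert_at i s xs) (insert_at j t ys)) \<le> real (lcs xs ys) + 2" by simp
    qed (use p in auto)
    then show ?thesis by (simp only: bexp2_add bexp2_const mean_lcs_def)
  qed
  \<comment> \<open>the gain from two zeros\<close>
  define a where "a = mean_ins p n i j False False - mean_lcs p n"
  have "mean_lcs p n + (1 - p)\<^sup>2 \<le> mean_lcs p (Suc n)" using p by (intro mean_lcs_Suc_ge) auto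
  also have "\<dots> = (\<Sum>s\<in>UNIV. \<Sum>t\<in>UNIV. bern_weight p s * bern_weight p t * mean_ins p n i j s t)"
    unfolding mean_lcs_def mean_ins_def by (rule bexp2_insert_at[OF ij])
  also have "\<dots> \<le> (\<Sum>s\<in>UNIV. \<Sum>t\<in>UNIV. bern_weight p s * bern_weight p t * (if s \<or> t then mean_lcs p n + 2 else mean_lcs p n + a))"
    using p up by (intro sum_mono mult_left_mono) (auto simp: bern_weight_def a_def)
  also have "\<dots> = mean_lcs p n + (1 - p)\<^sup>2 * a + 2 * (1 - (1 - p)\<^sup>2)"
    by (simp add: UNIV_bool bern_weight_def power2_eq_square algebra_simps)
  finally have "(1 - p)\<^sup>2 * (3 - a) \<le> 2" by (simp add: algebra_simps)
  have "1 - 6 * p \<le> a"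
  proof (rule ccontr)
    assume "\<not> 1 - 6 * p \<le> a"
    then have "(1 - p)\<^sup>2 * (2 + 6 * p) < (1 - p)\<^sup>2 * (3 - a)"
      using p by (intro mult_strict_left_mono) auto
    moreover have "(1 - p)\<^sup>2 * (2 + 6 * p) = 2 + p * (2 - 10 * p + 6 * p\<^sup>2)"
      by (simp add: power2_eq_square algebra_simps)
    moreover have "0 \<le> p * (2 - 10 * p + 6 * p\<^sup>2)"
      using p by (intro mult_nonneg_nonneg) auto
    ultimately show False using \<open>(1 - p)\<^sup>2 * (3 - a) \<le> 2\<close> by linarith
  qed
  then show ?thesis by (simp add: a_def)
qed

text \<open>
Seen from the longer words, the insertions are the deletions of all pairs of ones.  Deleting a
one loses something only if it is essential for the optimal common subsequence.
\<close>

lemma sum_mean_ins_True_True_le: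
  assumes p: "0 < p" "p \<le> exp (-56)" and m: "m = Suc n" "p * m \<ge> 256"
  shows "(\<Sum>i<m. \<Sum>j<m. mean_ins p n i j True True - mean_lcs p n) \<le> 3 / 8 * (real m)\<^sup>2"
proof -
  have "p < 1" using p(2) by (rule le_less_trans) simp
  let ?D = "\<lambda>i j xs ys. real (lcs xs ys) - real (lcs (delete_at i xs) (delete_at j ys))"
  have term_eq: "p\<^sup>2 * (mean_ins p n i j True True - mean_lcs p n)
      = bexp2 p m m (\<lambda>xs ys. of_bool (xs ! i \<and> ys ! j) * ?D i j xs ys)" if ij: "i < m" "j < m" for i j
  proof -
    have "bexp2 p m m (\<lambda>xs ys. of_bool (xs ! i = True \<and> ys ! j = True) * ?D i j xs ys)
        = p\<^sup>2 * bexp2 p n n (\<lambda>xs ys. ?D i j (insert_at i True xs) (insert_at j True ys))"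
      using bexp2_restrict_nth[of i n j n p True True "?D i j"] ij m(1)
      by (simp add: bern_weight_def power2_eq_square)
    also have "bexp2 p n n (\<lambda>xs ys. ?D i j (insert_at i True xs) (insert_at j True ys))
        = bexp2 p n n (\<lambda>xs ys. real (lcs (insert_at i True xs) (insert_at j True ys)) - real (lcs xs ys))"
      by (rule bexp2_cong) (use ij m in \<open>simp add: delete_at_insert_at\<close>)
    also have "\<dots> = mean_ins p n i j True True - mean_lcs p n"
      by (simp only: bexp2_diff mean_ins_def mean_lcs_def)
    finally show ?thesis by simp
  qed
  have ptw: "(\<Sum>i<m. \<Sum>j<m. of_bool (xs ! i \<and> ys ! j) * ?D i j xs ys)
      \<le> ones (opt_subseq xs ys) * ones ys + ones (opt_subseq xs ys) * ones xs"
    if len: "length xs = m" "length ys = m" for xs ys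
  proof -
    let ?z = "opt_subseq xs ys"
    let ?ex = "\<lambda>i. of_bool (xs ! i \<and> essential ?z xs i) :: real"
    let ?ey = "\<lambda>j. of_bool (ys ! j \<and> essential ?z ys j) :: real"
    have "?D i j xs ys \<le> of_bool (essential ?z xs i) + of_bool (essential ?z ys j)" for i j
    proof -
      have "real (lcs xs ys) \<le> real (lcs (delete_at i xs) (delete_at j ys) + of_bool (essential ?z xs i) + of_bool (essential ?z ys j))"
        using lcs_delete_at_ge[OF opt_subseq(1,2), of xs ys i j] unfolding opt_subseq(3) by (rule of_nat_mono)
      then show ?thesis by simp
    qed
    then have "(\<Sum>i<m. \<Sum>j<m. of_bool (xs ! i \<and> ys ! j) * ?D i j xs ys)
        \<le> (\<Sum>i<m. \<Sum>j<m. ?ex i * of_bool (ys ! j) + of_bool (xs ! i) * ?ey j)"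
      by (intro sum_mono) auto
    also have "\<dots> = (\<Sum>i<m. ?ex i) * (\<Sum>j<m. of_bool (ys ! j)) + (\<Sum>i<m. of_bool (xs ! i)) * (\<Sum>j<m. ?ey j)"
      by (simp only: sum.distrib sum_product)
    also have "\<dots> = (\<Sum>i<m. ?ex i) * ones ys + ones xs * (\<Sum>j<m. ?ey j)"
      by (simp only: ones_eq_sum len)
    also have "\<dots> \<le> ones ?z * ones ys + ones xs * ones ?z"
      using essential_True_le_ones[OF opt_subseq(1)[of xs ys]] essential_True_le_ones[OF opt_subseq(2)[of xs ys]]
      unfolding len by (intro add_mono mult_right_mono mult_left_mono ones_nonneg)
    finally show ?thesis by (simp add: mult.commute)
  qed
  have "p\<^sup>2 * (\<Sum>i<m. \<Sum>j<m. mean_ins p n i j True True - mean_lcs p n)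
      = (\<Sum>i<m. \<Sum>j<m. p\<^sup>2 * (mean_ins p n i j True True - mean_lcs p n))"
    by (simp only: sum_distrib_left)
  also have "\<dots> = (\<Sum>i<m. \<Sum>j<m. bexp2 p m m (\<lambda>xs ys. of_bool (xs ! i \<and> ys ! j) * ?D i j xs ys))"
    by (intro sum.cong refl term_eq) auto
  also have "\<dots> = bexp2 p m m (\<lambda>xs ys. \<Sum>i<m. \<Sum>j<m. of_bool (xs ! i \<and> ys ! j) * ?D i j xs ys)"
    by (simp only: bexp2_sum)
  also have "\<dots> \<le> bexp2 p m m (\<lambda>xs ys. ones (opt_subseq xs ys) * ones ys + ones (opt_subseq xs ys) * ones xs)"
    by (rule bexp2_mono) (use p \<open>p < 1\<close> ptw in auto)
  also have "\<dots> \<le> 3 / 16 * (p * m)\<^sup>2 + 3 / 16 * (p * m)\<^sup>2"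
    unfolding bexp2_add by (intro add_mono expected_opt_subseq_ones_times_ones_le p m)
  also have "\<dots> = p\<^sup>2 * (3 / 8 * (real m)\<^sup>2)"
    by (simp add: power_mult_distrib)
  finally show ?thesis using p by simp
qed

section \<open>A statistic that detects the insertions\<close>

text \<open>
The score statistic for the effect of changing a zero into a one at a random position of both words simultaneously.
\<close>

definition contrast :: "real \<Rightarrow> nat \<Rightarrow> bool list \<Rightarrow> bool list \<Rightarrow> real" where
  "contrast p m xs ys = ones xs * ones ys / p\<^sup>2 - (m - ones xs) * (m - ones ys) / (1 - p)\<^sup>2"

text \<open>
The products of counts are sums over pairs of positions, and restricting to words with given letters at
\<open>(i, j)\<close> yields inserted letters; the weights \<open>1 / p\<^sup>2\<close> and \<open>1 / (1 - p)\<^sup>2\<close> cancel the probabilities of these letters.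
\<close>

lemma bexp2_lcs_contrast:
  assumes p: "0 < p" "p < 1" and m: "m = Suc n"
  shows "bexp2 p m m (\<lambda>xs ys. lcs xs ys * contrast p m xs ys)
    = (\<Sum>i<m. \<Sum>j<m. mean_ins p n i j True True - mean_ins p n i j False False)"
proof -
  have prod_counts: "bexp2 p m m (\<lambda>xs ys. (\<Sum>i<m. of_bool (xs ! i = s)) * (\<Sum>j<m. of_bool (ys ! j = s)) * real (lcs xs ys))
      = (bern_weight p s)\<^sup>2 * (\<Sum>i<m. \<Sum>j<m. mean_ins p n i j s s)" for s
  proof -
    have "bexp2 p m m (\<lambda>xs ys. (\<Sum>i<m. of_bool (xs ! i = s)) * (\<Sum>j<m. of_bool (ys ! j = s)) * real (lcs xs ys))
       = (\<Sum>i<m. \<Sum>j<m. bexp2 p m m (\<lambda>xs ys. of_bool (xs ! i = s \<and> ys ! j = s) * real (lcs xs ys)))"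
      unfolding sum_product unfolding sum_distrib_right bexp2_sum of_bool_conj ..
    also have "\<dots> = (\<Sum>i<m. \<Sum>j<m. (bern_weight p s)\<^sup>2 * mean_ins p n i j s s)"
    proof (intro sum.cong refl)
      fix i j assume "i \<in> {..<m}" "j \<in> {..<m}"
      then show "bexp2 p m m (\<lambda>xs ys. of_bool (xs ! i = s \<and> ys ! j = s) * real (lcs xs ys)) = (bern_weight p s)\<^sup>2 * mean_ins p n i j s s"
        using bexp2_restrict_nth[of i n j n p s s "\<lambda>xs ys. real (lcs xs ys)"] m
        by (simp add: mean_ins_def power2_eq_square)
    qed
    finally show ?thesis by (simp only: sum_distrib_left)
  qed
  have "bexp2 p m m (\<lambda>xs ys. lcs xs ys * contrast p m xs ys)
    = bexp2 p m m (\<lambda>xs ys.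
        (1 / p\<^sup>2) * ((\<Sum>i<m. of_bool (xs ! i = True)) * (\<Sum>j<m. of_bool (ys ! j = True)) * real (lcs xs ys))
      - (1 / (1 - p)\<^sup>2) * ((\<Sum>i<m. of_bool (xs ! i = False)) * (\<Sum>j<m. of_bool (ys ! j = False)) * real (lcs xs ys)))"
  proof (rule bexp2_cong)
    fix xs ys :: "bool list" assume len: "length xs = m" "length ys = m"
    have counts: "(\<Sum>i<m. of_bool (xs ! i = True)) = ones xs" "(\<Sum>i<m. of_bool (ys ! i = True)) = ones ys"
      "(\<Sum>i<m. of_bool (xs ! i = False)) = m - ones xs" "(\<Sum>i<m. of_bool (ys ! i = False)) = m - ones ys"
      using ones_eq_sum[of xs] ones_eq_sum[of ys] zeros_eq_sum[of xs] zeros_eq_sum[of ys] len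
      by (simp_all del: sum_of_bool_eq)
    have "L * (u / P - v / Q) = (1 / P) * (u * L) - (1 / Q) * (v * L)" for L u v P Q :: real
      by (simp add: algebra_simps)
    then show "lcs xs ys * contrast p m xs ys = (1 / p\<^sup>2) * ((\<Sum>i<m. of_bool (xs ! i = True)) * (\<Sum>j<m. of_bool (ys ! j = True)) * real (lcs xs ys))
      - (1 / (1 - p)\<^sup>2) * ((\<Sum>i<m. of_bool (xs ! i = False)) * (\<Sum>j<m. of_bool (ys ! j = False)) * real (lcs xs ys))"
      unfolding counts contrast_def .
  qed
  also have "\<dots> = (\<Sum>i<m. \<Sum>j<m. mean_ins p n i j True True) - (\<Sum>i<m. \<Sum>j<m. mean_ins p n i j False False)"
    unfolding bexp2_diff bexp2_cmult prod_counts using p by (simp add: bern_weight_def)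
  finally show ?thesis by (simp only: sum_subtractf)
qed

text \<open>
In terms of the centred counts the constant parts \<open>m\<^sup>2\<close> of the two products cancel, which leaves linear terms of
standard deviation of order \<open>m * sqrt m\<close> and a smaller product.
\<close>

lemma contrast_centered:
  assumes "0 < p" "p < 1"
  shows "contrast p m xs ys = (1 / p + 1 / (1 - p)) * m * (ones xs - p * m) + (1 / p + 1 / (1 - p)) * m * (ones ys - p * m)
    + (1 / p\<^sup>2 - 1 / (1 - p)\<^sup>2) * ((ones xs - p * m) * (ones ys - p * m))"
proof -
  define a b r s where "a = ones xs - p * m" and "b = ones ys - p * m"
    and "r = 1 / p" and "s = 1 / (1 - p)"
  have "ones xs / p = m + a * r" "ones ys / p = m + b * r"
    "(m - ones xs) / (1 - p) = m - a * s" "(m - ones ys) / (1 - p) = m - b * s"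
    using assms by (simp_all add: a_def b_def r_def s_def field_simps)
  moreover have "contrast p m xs ys = (ones xs / p) * (ones ys / p) - ((m - ones xs) / (1 - p)) * ((m - ones ys) / (1 - p))"
    by (simp add: contrast_def power2_eq_square)
  ultimately have "contrast p m xs ys = (m + a * r) * (m + b * r) - (m - a * s) * (m - b * s)"
    by simp
  also have "\<dots> = (r + s) * m * a + (r + s) * m * b + (r\<^sup>2 - s\<^sup>2) * (a * b)"
    by (simp add: power2_eq_square algebra_simps)
  finally show ?thesis unfolding a_def b_def r_def s_def power_one_over .
qed

lemma bexp2_contrast:
  assumes "0 < p" "p < 1"
  shows "bexp2 p m m (contrast p m) = 0"
proof -
  have "bexp2 p m m (\<lambda>xs ys. contrast p m xs ys) = 0"
    unfolding contrast_centered[OF assms]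
    by (simp only: bexp2_add bexp2_cmult bexp2_prod bexp2_left bexp2_right bexp_ones_centered mult.assoc mult_1_right mult_zero_right add_0)
  then show ?thesis by simp
qed

lemma bexp2_contrast_squared_le:
  assumes p: "0 < p" "p < 1"
  obtains C where "C > 0" "\<And>m. bexp2 p m m (\<lambda>xs ys. (contrast p m xs ys)\<^sup>2) \<le> C * real m ^ 3"
proof -
  define a where "a = (1 / p + 1 / (1 - p))\<^sup>2"
  define b where "b = (1 / p\<^sup>2 - 1 / (1 - p)\<^sup>2)\<^sup>2"
  have ab: "a \<ge> 0" "b \<ge> 0" by (simp_all add: a_def b_def)
  have sq3: "(c * x + c * y + d * (x * y))\<^sup>2 \<le> 3 * c\<^sup>2 * x\<^sup>2 + 3 * c\<^sup>2 * y\<^sup>2 + 3 * d\<^sup>2 * (x\<^sup>2 * y\<^sup>2)"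
    for c d x y :: real
    using sum_squares_bound[of "c * x" "c * y"] sum_squares_bound[of "c * y" "d * (x * y)"]
      sum_squares_bound[of "c * x" "d * (x * y)"]
    by (simp add: power2_eq_square algebra_simps)
  have le: "bexp2 p m m (\<lambda>xs ys. (contrast p m xs ys)\<^sup>2) \<le> (6 * a + 3 * b + 1) * real m ^ 3" for m
  proof -
    let ?x = "\<lambda>xs. (ones xs - p * m)\<^sup>2"
    have "(contrast p m xs ys)\<^sup>2 \<le> 3 * a * (real m)\<^sup>2 * ?x xs + 3 * a * (real m)\<^sup>2 * ?x ys + 3 * b * (?x xs * ?x ys)" for xs ys
      using sq3[of "(1 / p + 1 / (1 - p)) * m" "ones xs - p * m" "ones ys - p * m" "1 / p\<^sup>2 - 1 / (1 - p)\<^sup>2"]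
      unfolding contrast_centered[OF p] a_def b_def power_mult_distrib mult.assoc .
    then have "bexp2 p m m (\<lambda>xs ys. (contrast p m xs ys)\<^sup>2)
        \<le> bexp2 p m m (\<lambda>xs ys. 3 * a * (real m)\<^sup>2 * ?x xs + 3 * a * (real m)\<^sup>2 * ?x ys + 3 * b * (?x xs * ?x ys))"
      using p by (intro bexp2_mono) auto
    also have "\<dots> = 6 * a * (real m)\<^sup>2 * (m * (p * (1 - p))) + 3 * b * (m * (p * (1 - p)))\<^sup>2"
      by (simp only: bexp2_add bexp2_cmult bexp2_prod bexp2_left bexp2_right bexp_ones_variance)
        (simp add: power2_eq_square)
    also have "\<dots> \<le> 6 * a * (real m)\<^sup>2 * m + 3 * b * (real m)\<^sup>2"
    proof -
      have "p * (1 - p) \<le> 1" using p by (intro mult_le_one) auto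
      then have "m * (p * (1 - p)) \<le> real m" "0 \<le> m * (p * (1 - p))"
        using p by (simp_all add: mult_left_le)
      then show ?thesis
        using ab by (intro add_mono mult_left_mono power_mono) auto
    qed
    also have "\<dots> = 6 * a * real m ^ 3 + 3 * b * (real m)\<^sup>2"
      by (simp add: power2_eq_square power3_eq_cube)
    also have "\<dots> \<le> 6 * a * real m ^ 3 + 3 * b * real m ^ 3"
    proof -
      have "(real m)\<^sup>2 \<le> real m ^ 3"
        by (cases "m = 0") (simp_all add: power_increasing)
      then show ?thesis using ab by (simp add: mult_left_mono)
    qed
    also have "\<dots> \<le> (6 * a + 3 * b + 1) * real m ^ 3" by (simp add: distrib_right)
    finally show ?thesis .
  qed
  show ?thesis by (rule that[OF _ le]) (use ab in linarith)
qed

section \<open>The variance grows linearly\<close>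

definition var_lcs :: "real \<Rightarrow> nat \<Rightarrow> real" where
  "var_lcs p m = bexp2 p m m (\<lambda>xs ys. (real (lcs xs ys) - mean_lcs p m)\<^sup>2)"

text \<open>
Summed over the \<open>m\<^sup>2\<close> pairs of positions, two zeros gain at least \<open>7/8\<close> each and two ones at most
\<open>3/8\<close> on average, so the covariance with \<open>contrast\<close> is at most \<open>- m\<^sup>2 / 2\<close>.
\<close>

lemma var_lcs_ge_large:
  assumes p: "0 < p" "p \<le> exp (-56)" and m: "p * m \<ge> 256"
    and C: "C > 0" "bexp2 p m m (\<lambda>xs ys. (contrast p m xs ys)\<^sup>2) \<le> C * real m ^ 3"
  shows "var_lcs p m \<ge> 1 / (4 * C) * m"
proof -
  have "p < 1" using p(2) by (rule le_less_trans) simp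
  have "p \<le> 1 / 48"
  proof -
    have "48 \<le> exp (56::real)" using exp_ge_add_one_self[of 56] by simp
    then have "exp (-56) \<le> (1/48::real)" by (simp add: exp_minus field_simps)
    with p show ?thesis by simp
  qed
  have "m \<noteq> 0"
  proof
    assume "m = 0"
    with m show False by simp
  qed
  then obtain n where n: "m = Suc n" by (cases m) auto
  have "bexp2 p m m (\<lambda>xs ys. (real (lcs xs ys) - mean_lcs p m) * contrast p m xs ys)
      = bexp2 p m m (\<lambda>xs ys. lcs xs ys * contrast p m xs ys - mean_lcs p m * contrast p m xs ys)"
    by (simp only: left_diff_distrib)
  also have "\<dots> = (\<Sum>i<m. \<Sum>j<m. mean_ins p n i j True True - mean_ins p n i j False False)"
    using bexp2_contrast[of p m] p \<open>p < 1\<close> by (simp add: bexp2_diff bexp2_cmult bexp2_lcs_contrast[OF p(1) \<open>p < 1\<close> n])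
  also have "\<dots> \<le> (\<Sum>i<m. \<Sum>j<m. (mean_ins p n i j True True - mean_lcs p n) - 7 / 8)"
  proof (intro sum_mono)
    fix i j assume "i \<in> {..<m}" "j \<in> {..<m}"
    then have "mean_lcs p n + 1 - 6 * p \<le> mean_ins p n i j False False"
      using p \<open>p \<le> 1/48\<close> n by (intro mean_ins_False_False_ge) auto
    with \<open>p \<le> 1/48\<close> show "mean_ins p n i j True True - mean_ins p n i j False False \<le> (mean_ins p n i j True True - mean_lcs p n) - 7 / 8"
      by simp
  qed
  also have "\<dots> = (\<Sum>i<m. \<Sum>j<m. mean_ins p n i j True True - mean_lcs p n) - 7 / 8 * (real m)\<^sup>2"
  proof -
    have "(\<Sum>i<m. \<Sum>j<m. g i j - 7 / 8) = (\<Sum>i<m. \<Sum>j<m. g i j) - 7 / 8 * (real m)\<^sup>2" for g :: "nat \<Rightarrow> nat \<Rightarrow> real"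
      by (simp add: sum_subtractf power2_eq_square)
    then show ?thesis .
  qed
  also have "\<dots> \<le> - (1 / 2) * (real m)\<^sup>2"
    using sum_mean_ins_True_True_le[OF p n m] by simp
  finally have cov: "(1 / 2) * (real m)\<^sup>2 \<le> - bexp2 p m m (\<lambda>xs ys. (real (lcs xs ys) - mean_lcs p m) * contrast p m xs ys)" by simp
  have V0: "var_lcs p m \<ge> 0"
    using bexp2_mono[of p m m "\<lambda>_ _. 0" "\<lambda>xs ys. (real (lcs xs ys) - mean_lcs p m)\<^sup>2"] p \<open>p < 1\<close>
    by (simp add: var_lcs_def)
  have "((1 / 2) * (real m)\<^sup>2)\<^sup>2 \<le> (- bexp2 p m m (\<lambda>xs ys. (real (lcs xs ys) - mean_lcs p m) * contrast p m xs ys))\<^sup>2"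
    by (rule power_mono[OF cov]) simp
  also have "\<dots> \<le> var_lcs p m * bexp2 p m m (\<lambda>xs ys. (contrast p m xs ys)\<^sup>2)"
    unfolding var_lcs_def power2_minus using p \<open>p < 1\<close> by (intro bexp2_Cauchy_Schwarz) auto
  also have "\<dots> \<le> var_lcs p m * (C * real m ^ 3)"
    by (intro mult_left_mono C V0)
  finally have "real m ^ 3 * (real m / 4) \<le> real m ^ 3 * (var_lcs p m * C)"
    by (simp add: power2_eq_square power3_eq_cube algebra_simps)
  then have "real m / 4 \<le> var_lcs p m * C" using \<open>m \<noteq> 0\<close> by simp
  then show ?thesis using C by (simp add: field_simps)
qed

text \<open>
Against the word of ones, the words of ones and of zeros give the values \<open>m\<close> and \<open>0\<close>, which cannot both be
close to the mean.
\<close>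

lemma var_lcs_ge_power:
  assumes p: "0 < p" "p \<le> 1/2"
  shows "var_lcs p m \<ge> p ^ (2 * m) / 4 * m"
proof -
  let ?F = "\<lambda>xs ys. (real (lcs xs ys) - mean_lcs p m)\<^sup>2"
  have ge: "p ^ (2 * m) * ?F (replicate m True) (replicate m b) \<le> var_lcs p m" for b
  proof -
    have nn: "0 \<le> bexp p m (?F xs)" for xs
      using bexp_mono[of p m "\<lambda>_. 0" "?F xs"] p by simp
    have "p ^ m * ?F (replicate m True) (replicate m b) \<le> bexp p m (?F (replicate m True))"
      by (rule bexp_ge_replicate) (use p in auto)
    then have "p ^ m * (p ^ m * ?F (replicate m True) (replicate m b)) \<le> p ^ m * bexp p m (?F (replicate m True))"
      using p by (intro mult_left_mono) auto
    also have "\<dots> \<le> var_lcs p m"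
      unfolding var_lcs_def bexp2_def by (rule bexp_ge_replicate[of p "\<lambda>xs. bexp p m (?F xs)"]) (use p nn in auto)
    finally show ?thesis by (simp add: mult_2 power_add mult.assoc)
  qed
  have L1: "lcs (replicate m True) (replicate m True) = m"
    using lcs_le_length[of "replicate m True" "replicate m True"] lcs_ge[of "replicate m True" "replicate m True" "replicate m True"] by simp
  have L0: "lcs (replicate m True) (replicate m False) = 0"
  proof -
    have "set zs \<subseteq> {b}" if "subseq zs (replicate m b)" for zs and b :: bool
      using that by (auto elim: list_emb_set)
    from this[OF opt_subseq(1)] this[OF opt_subseq(2)] have "opt_subseq (replicate m True) (replicate m False) = []"
      by (metis empty_iff insert_iff set_empty subset_singletonD)
    then show ?thesis using opt_subseq(3)[of "replicate m True" "replicate m False"] by simp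
  qed
  have "(real m)\<^sup>2 \<le> 2 * ((real m - mean_lcs p m)\<^sup>2 + (0 - mean_lcs p m)\<^sup>2)"
    using sum_squares_bound[of "real m - mean_lcs p m" "mean_lcs p m"] by (simp add: power2_eq_square algebra_simps)
  moreover have "real m \<le> (real m)\<^sup>2" by (cases m) (auto simp: power2_eq_square)
  ultimately have "real m \<le> 2 * ((real m - mean_lcs p m)\<^sup>2 + (0 - mean_lcs p m)\<^sup>2)"
    by (rule order_trans[rotated])
  then have "p ^ (2 * m) * real m \<le> p ^ (2 * m) * (2 * ((real m - mean_lcs p m)\<^sup>2 + (0 - mean_lcs p m)\<^sup>2))"
    using p by (intro mult_left_mono) auto
  with ge[of True] ge[of False] show ?thesis
    unfolding L1 L0 by (simp add: algebra_simps)
qed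

lemma var_lcs_linear_lower_bound:
  assumes p: "0 < p" "p \<le> exp (-56)"
  obtains c :: real where "c > 0" "\<And>m. var_lcs p m \<ge> c * m"
proof -
  have "exp (-56) \<le> (1/2::real)"
    using exp_ge_add_one_self[of 56] by (simp add: exp_minus field_simps)
  with p have p2: "p \<le> 1/2" "p < 1" by auto
  obtain C where C: "C > 0" "\<And>m. bexp2 p m m (\<lambda>xs ys. (contrast p m xs ys)\<^sup>2) \<le> C * real m ^ 3"
    using bexp2_contrast_squared_le[OF p(1) p2(2)] by blast
  \<comment> \<open>beyond this length the bound for long words applies\<close>
  define M where "M = nat \<lceil>256 / p\<rceil>"
  define c where "c = min (1 / (4 * C)) (p ^ (2 * M) / 4)"
  have "var_lcs p m \<ge> c * m" for m
  proof (cases "p * m \<ge> 256")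
    case True
    have "c * m \<le> 1 / (4 * C) * m" by (intro mult_right_mono) (auto simp: c_def)
    also have "\<dots> \<le> var_lcs p m" by (rule var_lcs_ge_large[OF p True C])
    finally show ?thesis .
  next
    case False
    then have "real m \<le> 256 / p" using p by (simp add: field_simps)
    then have "m \<le> M" unfolding M_def by linarith
    then have "p ^ (2 * M) \<le> p ^ (2 * m)" using p p2 by (intro power_decreasing) auto
    then have "c * m \<le> p ^ (2 * m) / 4 * m" by (intro mult_right_mono) (auto simp: c_def)
    also have "\<dots> \<le> var_lcs p m" by (rule var_lcs_ge_power[OF p(1) p2(1)])
    finally show ?thesis .
  qed
  moreover have "c > 0" using C p by (simp add: c_def)
  ultimately show ?thesis by (intro that)
qed

section \<open>Transfer to the probability space\<close>

text \<open>
Strictly increasing index maps into \<open>{1..n}\<close> are the subsequences of the list \<open>[1..<Suc n]\<close>.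
\<close>

lemma subseq_map_upt_iff:
  "(\<exists>i. strict_mono_on {1..k} i \<and> i ` {1..k} \<subseteq> {1..n} \<and> (\<forall>l\<in>{1..k}. zs ! (l - 1) = x (i l)))
    \<longleftrightarrow> subseq zs (map x [1..<Suc n])" if "length zs = k"
proof
  assume "\<exists>i. strict_mono_on {1..k} i \<and> i ` {1..k} \<subseteq> {1..n} \<and> (\<forall>l\<in>{1..k}. zs ! (l - 1) = x (i l))"
  then obtain i where i: "strict_mono_on {1..k} i" "i ` {1..k} \<subseteq> {1..n}" "\<forall>l\<in>{1..k}. zs ! (l - 1) = x (i l)"
    by blast
  have "subseq (map i [1..<Suc k]) [1..<Suc n]"
  proof (rule sorted_subset_imp_subseq)
    show "sorted_wrt (<) (map i [1..<Suc k])"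
      using i(1) by (auto simp: sorted_wrt_iff_nth_less strict_mono_on_def simp del: upt_Suc)
    show "set (map i [1..<Suc k]) \<subseteq> set [1..<Suc n]"
      using i(2) by (simp only: set_map set_upt atLeastLessThanSuc_atLeastAtMost)
  qed (simp del: upt_Suc)
  then have "subseq (map x (map i [1..<Suc k])) (map x [1..<Suc n])" by (rule subseq_map)
  moreover have "map x (map i [1..<Suc k]) = zs"
  proof (rule nth_equalityI)
    fix l assume "l < length (map x (map i [1..<Suc k]))"
    then show "map x (map i [1..<Suc k]) ! l = zs ! l"
      using i(3)[rule_format, of "Suc l"] by (simp del: upt_Suc)
  qed (simp add: that)
  ultimately show "subseq zs (map x [1..<Suc n])" by simp
next
  assume "subseq zs (map x [1..<Suc n])"
  then obtain N where N: "zs = nths (map x [1..<Suc n]) N" by (auto simp: subseq_conv_nths)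
  define ks where "ks = nths [1..<Suc n] N"
  have zs: "zs = map x ks" by (simp add: N ks_def nths_map)
  have ks: "sorted_wrt (<) ks" "set ks \<subseteq> {1..n}"
    by (auto simp: ks_def strict_sorted_iff sorted_nths simp del: upt_Suc dest: in_set_nthsD)
  define i where "i l = ks ! (l - 1)" for l
  have "length ks = k" using zs that by simp
  have "strict_mono_on {1..k} i"
    using ks(1) \<open>length ks = k\<close> by (auto simp: strict_mono_on_def i_def sorted_wrt_iff_nth_less)
  moreover have "i ` {1..k} \<subseteq> {1..n}"
  proof (rule image_subsetI)
    fix l assume "l \<in> {1..k}"
    then have "i l \<in> set ks" using \<open>length ks = k\<close> by (auto simp: i_def)
    then show "i l \<in> {1..n}" using ks(2) by blast
  qed
  moreover have "\<forall>l\<in>{1..k}. zs ! (l - 1) = x (i l)"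
    using \<open>length ks = k\<close> by (auto simp: zs i_def)
  ultimately show "\<exists>i. strict_mono_on {1..k} i \<and> i ` {1..k} \<subseteq> {1..n} \<and> (\<forall>l\<in>{1..k}. zs ! (l - 1) = x (i l))"
    by blast
qed

lemma common_subsequence_length_iff:
  "common_subsequence_length x y n k \<longleftrightarrow>
    (\<exists>zs. length zs = k \<and> subseq zs (map x [1..<Suc n]) \<and> subseq zs (map y [1..<Suc n]))"
proof
  assume "common_subsequence_length x y n k"
  then obtain i j where ij: "strict_mono_on {1..k} i" "i ` {1..k} \<subseteq> {1..n}"
    "strict_mono_on {1..k} j" "j ` {1..k} \<subseteq> {1..n}" "\<forall>l\<in>{1..k}. x (i l) = y (j l)"
    unfolding common_subsequence_length_def by blast
  define zs where "zs = map (\<lambda>l. x (i (Suc l))) [0..<k]"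
  have "length zs = k" by (simp add: zs_def)
  moreover have "subseq zs (map x [1..<Suc n])"
    unfolding subseq_map_upt_iff[OF \<open>length zs = k\<close>, symmetric]
    using ij(1,2) by (intro exI[of _ i]) (auto simp: zs_def)
  moreover have "subseq zs (map y [1..<Suc n])"
    unfolding subseq_map_upt_iff[OF \<open>length zs = k\<close>, symmetric]
    using ij(3-5) by (intro exI[of _ j]) (auto simp: zs_def)
  ultimately show "\<exists>zs. length zs = k \<and> subseq zs (map x [1..<Suc n]) \<and> subseq zs (map y [1..<Suc n])"
    by blast
next
  assume "\<exists>zs. length zs = k \<and> subseq zs (map x [1..<Suc n]) \<and> subseq zs (map y [1..<Suc n])"
  then obtain zs where zs: "length zs = k" "subseq zs (map x [1..<Suc n])" "subseq zs (map y [1..<Suc n])" by blast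
  from zs(2,3) show "common_subsequence_length x y n k"
    unfolding subseq_map_upt_iff[OF zs(1), symmetric] common_subsequence_length_def by metis
qed

lemma LCS_length_eq_lcs: "LCS_length x y n = lcs (map x [1..<Suc n]) (map y [1..<Suc n])"
  unfolding LCS_length_def lcs_def common_subsequence_length_iff
  by (rule arg_cong[of _ _ Max]) blast


lemma bexp_eq_sum:
  "bexp p n F = (\<Sum>xs | length xs = n. (\<Prod>i<n. bern_weight p (xs ! i)) * F xs)"
proof (induction n arbitrary: F)
  case (Suc n)
  let ?L = "{xs :: bool list. length xs = n}"
  have fin: "finite ?L" using finite_lists_length_eq[of "UNIV :: bool set" n] by simp
  have "{xs :: bool list. length xs = Suc n} = (\<lambda>(b, xs). b # xs) ` (UNIV \<times> ?L)"
    by (auto simp: length_Suc_conv)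
  then have "(\<Sum>xs | length xs = Suc n. (\<Prod>i<Suc n. bern_weight p (xs ! i)) * F xs)
      = (\<Sum>(b, xs)\<in>UNIV \<times> ?L. (\<Prod>i<Suc n. bern_weight p ((b # xs) ! i)) * F (b # xs))"
    by (simp add: sum.reindex inj_on_def case_prod_unfold del: prod.lessThan_Suc)
  also have "\<dots> = (\<Sum>b\<in>UNIV. \<Sum>xs\<in>?L. bern_weight p b * ((\<Prod>i<n. bern_weight p (xs ! i)) * F (b # xs)))"
    by (simp add: sum.cartesian_product prod.lessThan_Suc_shift mult.assoc del: prod.lessThan_Suc)
  also have "\<dots> = bexp p (Suc n) F"
    unfolding sum_distrib_left[symmetric] Suc.IH[symmetric] by (simp add: UNIV_bool bern_weight_def)
  finally show ?case by simp
qed simp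

text \<open>
The two words take finitely many values, and independence makes the probability of each pair of values a product of
letter probabilities.
\<close>

lemma expectation_eq_bexp2:
  fixes F :: "bool list \<Rightarrow> bool list \<Rightarrow> real"
  assumes ind: "indep_iid_bernoulli_sequences M p X Y" and p: "0 \<le> p" "p \<le> 1"
  shows "prob_space.expectation M (\<lambda>\<omega>. F (map (\<lambda>i. X i \<omega>) [1..<Suc n]) (map (\<lambda>i. Y i \<omega>) [1..<Suc n]))
    = bexp2 p n n F"
proof -
  interpret prob_space M using ind by (simp add: indep_iid_bernoulli_sequences_def)
  let ?l = "\<lambda>X \<omega>. map (\<lambda>i. X i \<omega>) [1..<Suc n]"
  let ?P = "PiM {1..} (\<lambda>_. count_space UNIV :: bool measure)"
  let ?L = "{xs :: bool list. length xs = n}"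
  have fin: "finite ?L" using finite_lists_length_eq[of "UNIV :: bool set" n] by simp
  \<comment> \<open>the values of the whole sequence for which the first n letters spell xs\<close>
  define S where "S xs = {f \<in> space ?P. \<forall>i\<in>{..<n}. f (Suc i) = xs ! i}" for xs
  have S: "S xs \<in> sets ?P" for xs
    unfolding S_def by (intro sets.sets_Collect_finite_All)
      (auto intro!: measurable_equality_set)
  have ev_eq: "(\<lambda>\<omega>. \<lambda>i\<in>{1..}. Z i \<omega>) -` S xs \<inter> space M = {\<omega>\<in>space M. ?l Z \<omega> = xs}"
    if "length xs = n" for Z xs
    using that by (auto simp: S_def space_PiM list_eq_iff_nth_eq Ball_def PiE_def simp del: upt_Suc)
  have marg: "prob {\<omega>\<in>space M. ?l Z \<omega> = xs} = (\<Prod>i<n. bern_weight p (xs ! i))"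
    if Z: "indep_vars (\<lambda>_. count_space UNIV) Z {1..}"
      and D: "\<forall>i\<ge>1. distr M (count_space UNIV) (Z i) = measure_pmf (bernoulli_pmf p)"
      and len: "length xs = n" for Z xs
  proof (cases "n = 0")
    case True
    with len show ?thesis by (simp add: prob_space)
  next
    case False
    have rv: "Z i \<in> measurable M (count_space UNIV)" if "i \<ge> 1" for i
      using Z that by (auto simp: indep_vars_def)
    have "?l Z \<omega> = xs \<longleftrightarrow> (\<forall>i\<in>Suc ` {..<n}. Z i \<omega> = xs ! (i - 1))" for \<omega>
      using len by (auto simp: list_eq_iff_nth_eq simp del: upt_Suc)
    then have "?l Z \<omega> = xs \<longleftrightarrow> (\<forall>i\<in>{1..n}. Z i \<omega> = xs ! (i - 1))" for \<omega>
      by (simp only: image_Suc_lessThan)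
    then have "{\<omega>\<in>space M. ?l Z \<omega> = xs} = (\<Inter>i\<in>{1..n}. Z i -` {xs ! (i - 1)} \<inter> space M)"
      using False by (simp only:) force
    also have "prob \<dots> = (\<Prod>i\<in>{1..n}. prob (Z i -` {xs ! (i - 1)} \<inter> space M))"
      using False by (intro indep_varsD[OF Z]) auto
    also have "\<dots> = (\<Prod>i\<in>{1..n}. bern_weight p (xs ! (i - 1)))"
    proof (rule prod.cong)
      fix i assume "i \<in> {1..n}"
      then have i: "i \<ge> 1" by simp
      have "prob (Z i -` {xs ! (i - 1)} \<inter> space M) = measure (distr M (count_space UNIV) (Z i)) {xs ! (i - 1)}"
        by (subst measure_distr) (use rv[OF i] in auto)
      also have "\<dots> = pmf (bernoulli_pmf p) (xs ! (i - 1))"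
        using D i by (simp add: pmf.rep_eq)
      also have "\<dots> = bern_weight p (xs ! (i - 1))" using p by (cases "xs ! (i - 1)") (auto simp: bern_weight_def)
      finally show "prob (Z i -` {xs ! (i - 1)} \<inter> space M) = bern_weight p (xs ! (i - 1))" .
    qed simp
    also have "\<dots> = (\<Prod>i<n. bern_weight p (xs ! i))"
      by (rule prod.reindex_bij_witness[of _ Suc "\<lambda>i. i - 1"]) auto
    finally show ?thesis .
  qed
  let ?E = "\<lambda>xs ys. {\<omega>\<in>space M. ?l X \<omega> = xs \<and> ?l Y \<omega> = ys}"
  have joint: "prob (?E xs ys) = (\<Prod>i<n. bern_weight p (xs ! i)) * (\<Prod>i<n. bern_weight p (ys ! i))"
    and meas: "?E xs ys \<in> events"
    if len: "length xs = n" "length ys = n" for xs ys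
  proof -
    have iv: "indep_var ?P (\<lambda>\<omega>. \<lambda>i\<in>{1..}. X i \<omega>) ?P (\<lambda>\<omega>. \<lambda>i\<in>{1..}. Y i \<omega>)"
      using ind by (simp add: indep_iid_bernoulli_sequences_def)
    have "?E xs ys = (\<lambda>\<omega>. (\<lambda>i\<in>{1..}. X i \<omega>, \<lambda>i\<in>{1..}. Y i \<omega>)) -` (S xs \<times> S ys) \<inter> space M"
      using ev_eq[OF len(1), of X] ev_eq[OF len(2), of Y] by blast
    then have "prob (?E xs ys) = prob {\<omega>\<in>space M. ?l X \<omega> = xs} * prob {\<omega>\<in>space M. ?l Y \<omega> = ys}"
      using indep_varD[OF iv S S, of xs ys] ev_eq[OF len(1), of X] ev_eq[OF len(2), of Y] by simp
    then show "prob (?E xs ys) = (\<Prod>i<n. bern_weight p (xs ! i)) * (\<Prod>i<n. bern_weight p (ys ! i))"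
      using marg[of X xs] marg[of Y ys] ind len by (simp add: indep_iid_bernoulli_sequences_def)
    have "?E xs ys = ((\<lambda>\<omega>. \<lambda>i\<in>{1..}. X i \<omega>) -` S xs \<inter> space M) \<inter> ((\<lambda>\<omega>. \<lambda>i\<in>{1..}. Y i \<omega>) -` S ys \<inter> space M)"
      using ev_eq[OF len(1), of X] ev_eq[OF len(2), of Y] by blast
    then show "?E xs ys \<in> events"
      using indep_var_rv1[OF iv] indep_var_rv2[OF iv] S by (auto intro!: measurable_sets)
  qed
  have "expectation (\<lambda>\<omega>. F (?l X \<omega>) (?l Y \<omega>))
      = expectation (\<lambda>\<omega>. \<Sum>xs\<in>?L. \<Sum>ys\<in>?L. F xs ys * indicator (?E xs ys) \<omega>)"
  proof (rule Bochner_Integration.integral_cong[OF refl])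
    fix \<omega> assume "\<omega> \<in> space M"
    have "(\<Sum>xs\<in>?L. \<Sum>ys\<in>?L. F xs ys * indicator (?E xs ys) \<omega>)
        = (\<Sum>xs\<in>?L. \<Sum>ys\<in>?L. if ?l Y \<omega> = ys then (if ?l X \<omega> = xs then F xs ys else 0) else 0)"
      using \<open>\<omega> \<in> space M\<close> by (intro sum.cong refl) (auto simp: indicator_def)
    also have "\<dots> = F (?l X \<omega>) (?l Y \<omega>)"
      using fin by (simp del: upt_Suc)
    finally show "F (?l X \<omega>) (?l Y \<omega>) = (\<Sum>xs\<in>?L. \<Sum>ys\<in>?L. F xs ys * indicator (?E xs ys) \<omega>)" by simp
  qed
  also have "\<dots> = (\<Sum>xs\<in>?L. \<Sum>ys\<in>?L. F xs ys * prob (?E xs ys))"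
  proof -
    have "expectation (\<lambda>\<omega>. \<Sum>xs\<in>?L. \<Sum>ys\<in>?L. F xs ys * indicator (E xs ys) \<omega>)
        = (\<Sum>xs\<in>?L. \<Sum>ys\<in>?L. F xs ys * prob (E xs ys))"
      if E: "\<And>xs ys. length xs = n \<Longrightarrow> length ys = n \<Longrightarrow> E xs ys \<in> events" for E
    proof -
      have int: "integrable M (\<lambda>\<omega>. F xs ys * indicator (E xs ys) \<omega>)" if "length xs = n" "length ys = n" for xs ys
        using E[OF that] by (intro integrable_mult_right integrable_real_indicator) (auto simp: emeasure_eq_measure)
      have "expectation (\<lambda>\<omega>. \<Sum>xs\<in>?L. \<Sum>ys\<in>?L. F xs ys * indicator (E xs ys) \<omega>)
          = (\<Sum>xs\<in>?L. expectation (\<lambda>\<omega>. \<Sum>ys\<in>?L. F xs ys * indicator (E xs ys) \<omega>))"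
        by (intro Bochner_Integration.integral_sum Bochner_Integration.integrable_sum int) auto
      also have "\<dots> = (\<Sum>xs\<in>?L. \<Sum>ys\<in>?L. expectation (\<lambda>\<omega>. F xs ys * indicator (E xs ys) \<omega>))"
        by (intro sum.cong refl Bochner_Integration.integral_sum int) auto
      also have "\<dots> = (\<Sum>xs\<in>?L. \<Sum>ys\<in>?L. F xs ys * prob (E xs ys))"
        using E by (intro sum.cong refl) (simp)
      finally show ?thesis .
    qed
    from this[of ?E] meas show ?thesis by blast
  qed
  also have "\<dots> = bexp2 p n n F"
    unfolding bexp2_def bexp_eq_sum sum_distrib_left using joint
    by (intro sum.cong refl) (simp add: mult_ac)
  finally show ?thesis .
qed

section \<open>The lower bound for the variance\<close>

theorem theorem2p1:
  "\<exists>\<epsilon>\<^sub>0::real. 0 < \<epsilon>\<^sub>0 \<and> \<epsilon>\<^sub>0 \<le> 1/2 \<and>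
     (\<forall>\<epsilon>. 0 < \<epsilon> \<and> \<epsilon> < \<epsilon>\<^sub>0 \<longrightarrow>
       (\<exists>c::real. c > 0 \<and>
         (\<forall>(M::'a measure) X Y. indep_iid_bernoulli_sequences M \<epsilon> X Y \<longrightarrow>
           (\<forall>n\<ge>1. prob_space.variance M
                    (\<lambda>\<omega>. real (LCS_length (\<lambda>i. X i \<omega>) (\<lambda>i. Y i \<omega>) n)) \<ge> c * real n))))"
proof (rule exI[of _ "exp (-56)"], intro conjI allI impI)
  show half: "exp (-56) \<le> (1/2::real)"
    using exp_ge_add_one_self[of 56] by (simp add: exp_minus field_simps)
  fix p :: real assume p: "0 < p \<and> p < exp (-56)"
  with half have p': "0 < p" "p \<le> exp (-56)" "0 \<le> p" "p \<le> 1" by auto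
  obtain c where c: "c > 0" "\<And>m. c * real m \<le> var_lcs p m"
    using var_lcs_linear_lower_bound[OF p'(1,2)] by blast
  show "\<exists>c::real. c > 0 \<and> (\<forall>(M::'a measure) X Y. indep_iid_bernoulli_sequences M p X Y \<longrightarrow>
           (\<forall>n\<ge>1. prob_space.variance M
                    (\<lambda>\<omega>. real (LCS_length (\<lambda>i. X i \<omega>) (\<lambda>i. Y i \<omega>) n)) \<ge> c * real n))"
  proof (intro exI[of _ c] conjI allI impI c(1))
    fix M :: "'a measure" and X Y and n :: nat
    assume "1 \<le> n" and ind: "indep_iid_bernoulli_sequences M p X Y"
    note eq = expectation_eq_bexp2[OF ind p'(3,4), of _ n]
    have "prob_space.variance M (\<lambda>\<omega>. real (LCS_length (\<lambda>i. X i \<omega>) (\<lambda>i. Y i \<omega>) n)) = var_lcs p n"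
      unfolding var_lcs_def mean_lcs_def LCS_length_eq_lcs eq[of "\<lambda>xs ys. real (lcs xs ys)"]
      by (rule eq[of "\<lambda>xs ys. (real (lcs xs ys) - bexp2 p n n (\<lambda>xs ys. real (lcs xs ys)))\<^sup>2"])
    with c(2) show "c * real n \<le> prob_space.variance M (\<lambda>\<omega>. real (LCS_length (\<lambda>i. X i \<omega>) (\<lambda>i. Y i \<omega>) n))"
      by simp
  qed
qed simp

end
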